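(* Let $\mathcal X$ be a finite set and let $R,S\subseteq\mathcal S(\mathcal X)$ be non-empty sets of probability density functions on $\mathcal X$ such that $D(\rho\|S)<D_\infty^*(\rho\|S)$ for every $\rho\in R$. Let $\overline{\mathrm{co}}(S)$ be the closed convex hull of $S$. Then for any $r>0$, \begin{align*} H_r^*(R\|\overline{\mathrm{co}}(S))&=\sup_{\rho\in R,\,\sigma\in\overline{\mathrm{co}}(S)}\mathrm{sc}_r(\rho\|\sigma)\\ &\ge\mathrm{sc}_r^{\{0\}}\big(R\,\|\,(\overline{\mathrm{co}}(S)^{(n)}_{\mathrm{adv}})_{n}\big)\ge\mathrm{sc}_r^{\{0\}}\big(R\,\|\,(S^{(n)}_{\mathrm{adv}})_{n}\big)\\ &\ge\mathrm{sc}_r^{\{0\}}\big(R\,\|\,(S^{\otimes n}_{\mathrm{av}})_{n}\big)=\mathrm{sc}_r^{\{0\}}\big(R\,\|\,(\overline{\mathrm{co}}(S)^{\otimes n}_{\mathrm{av}})_{n}\big)\\ &\ge\mathrm{sc}_r^{\{0\}}(R\|\overline{\mathrm{co}}(S))\ge\mathrm{sc}_r^{\{0,1\}}(R\|\overline{\mathrm{co}}(S))\\ &\ge\sup_{\rho\in R,\,\sigma\in\overline{\mathrm{co}}(S)}\mathrm{sc}_r(\rho\|\sigma), \end{align*} and hence all these inequalities hold as equalities.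
   Context: $\mathcal S(\mathcal X)$ is the set of probability density functions on $\mathcal X$; $\log$ is natural, $-\log0=+\infty$. Divergences: $D(\rho\|\sigma)=\sum_x\rho(x)\log\frac{\rho(x)}{\sigma(x)}$ if $\operatorname{supp}\rho\subseteq\operatorname{supp}\sigma$, else $+\infty$; for $\alpha>1$, $D_\alpha(\rho\|\sigma)=\frac1{\alpha-1}\log\sum_x\rho(x)^\alpha\sigma(x)^{1-\alpha}$ (sum over $\operatorname{supp}\rho$) if $\operatorname{supp}\rho\subseteq\operatorname{supp}\sigma$, else $+\infty$; $D_\infty^*(\rho\|\sigma)=\inf\{\lambda:\rho\le e^\lambda\sigma\}$; $D(\rho\|S)=\inf_{\sigma\in S}D(\rho\|\sigma)$, $D_\infty^*(\rho\|S)=\inf_{\sigma\in S}D_\infty^*(\rho\|\sigma)$. Hoeffding anti-divergence: $H_r^*(\rho\|\sigma)=\max\big\{0,\sup_{\alpha>1}\frac{\alpha-1}\alpha[r-D_\alpha(\rho\|\sigma)]\big\}$ and $H_r^*(R\|A)=\sup_{\rho\in R,\sigma\in A}H_r^*(\rho\|\sigma)$. Alternative hypotheses on $n$ samples for $A\subseteq\mathcal S(\mathcal X)$: i.i.d. $A^{\otimes n}=\{\sigma^{\otimes n}:\sigma\in A\}$; arbitrarily varying $A^{\otimes n}_{\mathrm{av}}=\{\sigma_1\otimes\dots\otimes\sigma_n:\sigma_k\in A\}$; adversarial $A^{(n)}_{\mathrm{adv}}$: all $\sigma\in\mathcal S(\mathcal X^n)$ whose first marginal is in $A$ and such that for all $k=1,\dots,n-1$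 and $(x_1,\dots,x_k)\in\mathcal X^k$ (of positive probability, so that it is defined) the conditional distribution $\sigma_{k+1}(\cdot|x_1\dots x_k)$ of the $(k+1)$-th coordinate given the first $k$ is in $A$. A test is $T_n:\mathcal X^n\to[0,1]$, $\omega(T_n)=\sum_{\underline x}\omega(\underline x)T_n(\underline x)$. For an alternative hypothesis $(S_n)_n$, $S_n\subseteq\mathcal S(\mathcal X^n)$, the relaxed strong converse exponent $\mathrm{sc}_r^{\{0\}}(R\|(S_n)_n)$ is the infimum of $\sup_{\rho\in R}\limsup_n-\frac1n\log\rho^{\otimes n}(T_n)$ over all test sequences with $\liminf_n-\frac1n\log\sup_{\sigma\in S_n}\sigma(T_n)\ge r$; $\mathrm{sc}_r^{\{0\}}(R\|A)$ is this with $S_n=A^{\otimes n}$. $\mathrm{sc}_r^{\{0,1\}}(R\|A)$ is the infimum of $\sup_{\rho\in R}\limsup_n-\frac1n\log\rho^{\otimes n}(T_n)$ over all test sequences with $\liminf_n-\frac1n\log\sigma^{\otimes n}(T_n)\ge r$ for every $\sigma\in A$. $\mathrm{sc}_r(\rho\|\sigma)=\mathrm{sc}_r^{\{0\}}(\{\rho\}\|\{\sigma\})$. *)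

theory Defs
  imports "HOL-Analysis.Analysis"
begin

text \<open>
  The finite set \<open>X\<close> is the type \<open>'a::finite\<close>; densities on \<open>X\<close> are vectors in \<open>real ^ 'a\<close>, so that
  closed convex hulls are the library's \<open>closure (convex hull S)\<close>. The set \<open>X^n\<close> consists of the
  words of length \<open>n\<close>, and a density on \<open>X^n\<close> is a function on all words that vanishes on words of
  any other length.
\<close>

definition densities :: "(real ^ 'a::finite) set" where
  "densities = {\<rho>. (\<forall>x. 0 \<le> \<rho> $ x) \<and> (\<Sum>x\<in>UNIV. \<rho> $ x) = 1}"

definition words :: "nat \<Rightarrow> 'a::finite list set" where
  "words n = {xs. length xs = n}"

definition word_densities :: "nat \<Rightarrow> ('a::finite list \<Rightarrow> real) set" where
  "word_densities n =
     {\<omega>. (\<forall>xs. 0 \<le> \<omega> xs) \<and> (\<forall>xs. xs \<notin> words n \<longrightarrow> \<omega> xs = 0) \<and> (\<Sum>xs\<in>words n. \<omega> xs) = 1}"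


section \<open>Divergences\<close>

definition supp :: "real ^ 'a::finite \<Rightarrow> 'a set" where
  "supp \<rho> = {x. \<rho> $ x \<noteq> 0}"

definition rel_entropy :: "real ^ 'a::finite \<Rightarrow> real ^ 'a \<Rightarrow> ereal" where
  "rel_entropy \<rho> \<sigma> =
     (if supp \<rho> \<subseteq> supp \<sigma> then ereal (\<Sum>x\<in>supp \<rho>. \<rho> $ x * ln (\<rho> $ x / \<sigma> $ x)) else \<infinity>)"

definition renyi_div :: "real \<Rightarrow> real ^ 'a::finite \<Rightarrow> real ^ 'a \<Rightarrow> ereal" where
  "renyi_div \<alpha> \<rho> \<sigma> =
     (if supp \<rho> \<subseteq> supp \<sigma>
      then ereal (1 / (\<alpha> - 1) * ln (\<Sum>x\<in>supp \<rho>. (\<rho> $ x) powr \<alpha> * (\<sigma> $ x) powr (1 - \<alpha>)))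
      else \<infinity>)"

text \<open>The infimum is taken in the extended reals, so it is \<open>\<infinity>\<close> if no real \<open>c\<close> qualifies.\<close>

definition max_div :: "real ^ 'a::finite \<Rightarrow> real ^ 'a \<Rightarrow> ereal" where
  "max_div \<rho> \<sigma> = Inf (ereal ` {c. \<forall>x. \<rho> $ x \<le> exp c * \<sigma> $ x})"

definition rel_entropy_set :: "real ^ 'a::finite \<Rightarrow> (real ^ 'a) set \<Rightarrow> ereal" where
  "rel_entropy_set \<rho> S = (INF \<sigma>\<in>S. rel_entropy \<rho> \<sigma>)"

definition max_div_set :: "real ^ 'a::finite \<Rightarrow> (real ^ 'a) set \<Rightarrow> ereal" where
  "max_div_set \<rho> S = (INF \<sigma>\<in>S. max_div \<rho> \<sigma>)"

definition hoeffding_anti :: "real \<Rightarrow> real ^ 'a::finite \<Rightarrow> real ^ 'a \<Rightarrow> ereal" where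
  "hoeffding_anti r \<rho> \<sigma> =
     max 0 (SUP \<alpha>\<in>{1<..}. ereal ((\<alpha> - 1) / \<alpha>) * (ereal r - renyi_div \<alpha> \<rho> \<sigma>))"

definition hoeffding_anti_set :: "real \<Rightarrow> (real ^ 'a::finite) set \<Rightarrow> (real ^ 'a) set \<Rightarrow> ereal" where
  "hoeffding_anti_set r R A = (SUP \<rho>\<in>R. SUP \<sigma>\<in>A. hoeffding_anti r \<rho> \<sigma>)"


section \<open>Alternative hypotheses on \<open>n\<close> samples\<close>

definition tensor :: "nat \<Rightarrow> (nat \<Rightarrow> real ^ 'a::finite) \<Rightarrow> 'a list \<Rightarrow> real" where
  "tensor n s xs = (if xs \<in> words n then \<Prod>k<n. s k $ (xs ! k) else 0)"

definition tensor_power :: "nat \<Rightarrow> real ^ 'a::finite \<Rightarrow> 'a list \<Rightarrow> real" where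
  "tensor_power n \<rho> = tensor n (\<lambda>_. \<rho>)"

definition iid :: "(real ^ 'a::finite) set \<Rightarrow> nat \<Rightarrow> ('a list \<Rightarrow> real) set" where
  "iid A n = tensor_power n ` A"

definition arb_varying :: "(real ^ 'a::finite) set \<Rightarrow> nat \<Rightarrow> ('a list \<Rightarrow> real) set" where
  "arb_varying A n = {tensor n s | s. \<forall>k<n. s k \<in> A}"

text \<open>The probability, under a density on words of length \<open>n\<close>, of having \<open>xs\<close> as a prefix.\<close>

definition prefix_marginal :: "nat \<Rightarrow> ('a::finite list \<Rightarrow> real) \<Rightarrow> 'a list \<Rightarrow> real" where
  "prefix_marginal n \<omega> xs = (\<Sum>ys\<in>words (n - length xs). \<omega> (xs @ ys))"

definition conditional :: "nat \<Rightarrow> ('a::finite list \<Rightarrow> real) \<Rightarrow> 'a list \<Rightarrow> real ^ 'a" where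
  "conditional n \<omega> xs = (\<chi> x. prefix_marginal n \<omega> (xs @ [x]) / prefix_marginal n \<omega> xs)"

definition adversarial :: "(real ^ 'a::finite) set \<Rightarrow> nat \<Rightarrow> ('a list \<Rightarrow> real) set" where
  "adversarial A n =
     {\<omega> \<in> word_densities n.
        (\<chi> x. prefix_marginal n \<omega> [x]) \<in> A \<and>
        (\<forall>k\<in>{1..<n}. \<forall>xs\<in>words k. 0 < prefix_marginal n \<omega> xs \<longrightarrow> conditional n \<omega> xs \<in> A)}"


section \<open>Tests and strong converse exponents\<close>

definition test_seqs :: "(nat \<Rightarrow> 'a::finite list \<Rightarrow> real) set" where
  "test_seqs = {T. \<forall>n. \<forall>xs\<in>words n. 0 \<le> T n xs \<and> T n xs \<le> 1}"

definition test_prob :: "nat \<Rightarrow> ('a::finite list \<Rightarrow> real) \<Rightarrow> ('a list \<Rightarrow> real) \<Rightarrow> real" where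
  "test_prob n \<omega> t = (\<Sum>xs\<in>words n. \<omega> xs * t xs)"

definition neg_log :: "real \<Rightarrow> ereal" where
  "neg_log p = (if p = 0 then \<infinity> else ereal (- ln p))"

text \<open>Its value at \<open>n = 0\<close> is irrelevant, as it is only used under \<open>liminf\<close> and \<open>limsup\<close>.\<close>

definition rate :: "nat \<Rightarrow> real \<Rightarrow> ereal" where
  "rate n p = ereal (1 / real n) * neg_log p"

definition success_exponent ::
    "(real ^ 'a::finite) set \<Rightarrow> (nat \<Rightarrow> 'a list \<Rightarrow> real) \<Rightarrow> ereal" where
  "success_exponent R T =
     (SUP \<rho>\<in>R. limsup (\<lambda>n. rate n (test_prob n (tensor_power n \<rho>) (T n))))"

text \<open>
  The inner supremum below is a supremum of reals; it is meaningful because for \<open>n \<ge> 1\<close> the sets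
  \<open>S n\<close> are intended to be non-empty sets of densities, whence the values lie in \<open>[0, 1]\<close>.
\<close>

definition sc0 ::
    "real \<Rightarrow> (real ^ 'a::finite) set \<Rightarrow> (nat \<Rightarrow> ('a list \<Rightarrow> real) set) \<Rightarrow> ereal" where
  "sc0 r R S =
     (INF T\<in>{T \<in> test_seqs.
          liminf (\<lambda>n. rate n (SUP \<omega>\<in>S n. test_prob n \<omega> (T n))) \<ge> ereal r}.
        success_exponent R T)"

definition sc01 :: "real \<Rightarrow> (real ^ 'a::finite) set \<Rightarrow> (real ^ 'a) set \<Rightarrow> ereal" where
  "sc01 r R A =
     (INF T\<in>{T \<in> test_seqs.
          \<forall>\<sigma>\<in>A. liminf (\<lambda>n. rate n (test_prob n (tensor_power n \<sigma>) (T n))) \<ge> ereal r}.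
        success_exponent R T)"

definition sc :: "real \<Rightarrow> real ^ 'a::finite \<Rightarrow> real ^ 'a \<Rightarrow> ereal" where
  "sc r \<rho> \<sigma> = sc0 r {\<rho>} (iid {\<sigma>})"

end

theory Submission
  imports Defs "HOL-Real_Asymp.Real_Asymp"
begin

text \<open>
  Everything is squeezed between the Hoeffding anti-divergence and the exponent of the simple
  problems, so only two bounds need work: the converse \<open>H\<^sup>* \<le> sc\<close> for a pair, which is a change of
  measure, and the achievability of \<open>H\<^sup>*\<close> against the adversary. For the latter, an e-variable is a
  function \<open>f > 0\<close> with \<open>\<Sum>x. \<sigma> x * f x \<le> 1\<close> for all \<open>\<sigma>\<close> in the closed convex hull \<open>C\<close>. Products of an
  e-variable along a word are supermartingales under every adversary, so the test
  \<open>min 1 (e^(- n r) \<Prod>k. f (x k))\<close> has type II error at most \<open>e^(- n r)\<close>, and under \<open>\<rho>\<close> its success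
  exponent is \<open>max {t r - ln (\<Sum>x. \<rho> x * f x powr t) | 0 \<le> t \<le> 1}\<close>. For fixed \<open>t = (\<alpha> - 1) / \<alpha>\<close> the best
  e-variable is proportional to \<open>(\<rho> / \<sigma>) powr \<alpha>\<close>, where \<open>\<sigma>\<close> minimises the Renyi divergence over \<open>C\<close>;
  a minimax argument in \<open>t\<close> makes one e-variable good for all \<open>t\<close>, and averaging over a countable
  dense set of e-variables makes one test good for all \<open>\<rho>\<close>.
\<close>

section \<open>Sums over words\<close>

lemma finite_words [simp]: "finite (words n :: 'a::finite list set)"
  unfolding words_def using finite_lists_length_eq[of "UNIV :: 'a set" n] by simp

lemma words_0: "words 0 = {[]}"
  by (auto simp: words_def)

lemma sum_words_Suc:
  "(\<Sum>xs\<in>words (Suc n). F xs) = (\<Sum>x\<in>UNIV. \<Sum>xs\<in>words n. F (x # xs))"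
proof -
  have "(\<Sum>xs\<in>words (Suc n). F xs) = (\<Sum>(x, xs)\<in>UNIV \<times> words n. F (x # xs))"
    by (rule sum.reindex_bij_witness[where i = "\<lambda>(x, xs). x # xs" and j = "\<lambda>xs. (hd xs, tl xs)"])
      (auto simp: words_def length_Suc_conv)
  then show ?thesis by (simp add: sum.cartesian_product)
qed

lemma sum_words_snoc:
  "(\<Sum>xs\<in>words (Suc n). F xs) = (\<Sum>xs\<in>words n. \<Sum>x\<in>UNIV. F (xs @ [x]))"
proof -
  have "(\<Sum>xs\<in>words (Suc n). F xs) = (\<Sum>(xs, x)\<in>words n \<times> UNIV. F (xs @ [x]))"
    by (rule sum.reindex_bij_witness[where i = "\<lambda>(xs, x). xs @ [x]" and j = "\<lambda>xs. (butlast xs, last xs)"])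
      (auto simp: words_def length_Suc_conv_rev)
  then show ?thesis by (simp add: sum.cartesian_product)
qed

lemma sum_words_prod:
  fixes h :: "nat \<Rightarrow> 'a::finite \<Rightarrow> real"
  shows "(\<Sum>xs\<in>words n. \<Prod>k<n. h k (xs ! k)) = (\<Prod>k<n. \<Sum>x\<in>UNIV. h k x)"
proof (induction n arbitrary: h)
  case 0
  then show ?case by (simp add: words_0)
next
  case (Suc n)
  have "(\<Sum>xs\<in>words (Suc n). \<Prod>k<Suc n. h k (xs ! k))
      = (\<Sum>x\<in>UNIV. \<Sum>xs\<in>words n. h 0 x * (\<Prod>k<n. h (Suc k) (xs ! k)))"
    by (simp add: sum_words_Suc prod.lessThan_Suc_shift del: prod.lessThan_Suc)
  also have "\<dots> = (\<Sum>x\<in>UNIV. h 0 x) * (\<Prod>k<n. \<Sum>x\<in>UNIV. h (Suc k) x)"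
    by (simp add: Suc.IH[symmetric] sum_product)
  also have "\<dots> = (\<Prod>k<Suc n. \<Sum>x\<in>UNIV. h k x)"
    by (simp add: prod.lessThan_Suc_shift del: prod.lessThan_Suc)
  finally show ?case .
qed

section \<open>Densities, their tensor powers, and moments of i.i.d. sums\<close>

lemma densities_nonneg: "\<rho> \<in> densities \<Longrightarrow> 0 \<le> \<rho> $ x"
  and densities_sum: "\<rho> \<in> densities \<Longrightarrow> (\<Sum>x\<in>UNIV. \<rho> $ x) = 1"
  by (auto simp: densities_def)

lemma densities_pos_iff: "\<rho> \<in> densities \<Longrightarrow> 0 < \<rho> $ x \<longleftrightarrow> x \<in> supp \<rho>"
  using densities_nonneg[of \<rho> x] by (auto simp: supp_def)

lemma tensor_power_word: "xs \<in> words n \<Longrightarrow> tensor_power n \<rho> xs = (\<Prod>k<n. \<rho> $ (xs ! k))"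
  by (simp add: tensor_power_def tensor_def)

lemma tensor_word_density:
  assumes "\<And>k. k < n \<Longrightarrow> s k \<in> densities"
  shows "tensor n s \<in> word_densities n"
proof -
  have "(\<Sum>xs\<in>words n. tensor n s xs) = (\<Sum>xs\<in>words n. \<Prod>k<n. s k $ (xs ! k))"
    by (simp add: tensor_def)
  also have "\<dots> = 1"
    using assms sum_words_prod[of "\<lambda>k x. s k $ x" n] by (simp add: densities_sum)
  finally show ?thesis
    using assms by (auto simp: word_densities_def tensor_def intro!: prod_nonneg densities_nonneg)
qed

lemma tensor_power_word_density: "\<rho> \<in> densities \<Longrightarrow> tensor_power n \<rho> \<in> word_densities n"
  unfolding tensor_power_def by (rule tensor_word_density)

lemma test_prob_bounds:
  assumes "\<omega> \<in> word_densities n" and "\<And>xs. xs \<in> words n \<Longrightarrow> 0 \<le> t xs \<and> t xs \<le> 1"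
  shows "0 \<le> test_prob n \<omega> t" and "test_prob n \<omega> t \<le> 1"
proof -
  show "0 \<le> test_prob n \<omega> t"
    using assms by (auto simp: test_prob_def word_densities_def intro!: sum_nonneg)
  have "test_prob n \<omega> t \<le> (\<Sum>xs\<in>words n. \<omega> xs)"
    unfolding test_prob_def using assms
    by (intro sum_mono mult_left_le) (auto simp: word_densities_def)
  then show "test_prob n \<omega> t \<le> 1"
    using assms(1) by (simp add: word_densities_def)
qed

lemma tensor_power_Cons:
  assumes "xs \<in> words n"
  shows "tensor_power (Suc n) \<rho> (x # xs) = \<rho> $ x * tensor_power n \<rho> xs"
proof -
  have "x # xs \<in> words (Suc n)" using assms by (simp add: words_def)
  then show ?thesis
    using assms by (simp add: tensor_power_word prod.lessThan_Suc_shift del: prod.lessThan_Suc)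
qed

text \<open>Mean and variance of an i.i.d. sum of centred variables. Splitting off the first letter
  leaves a cross term that vanishes because \<open>g\<close> is centred and the shorter sum has mean
  zero, so both claims share one induction.\<close>

lemma tensor_power_moments:
  fixes g :: "'a::finite \<Rightarrow> real"
  assumes \<rho>: "\<rho> \<in> densities" and g: "(\<Sum>x\<in>UNIV. \<rho> $ x * g x) = 0"
  shows "(\<Sum>xs\<in>words n. tensor_power n \<rho> xs * (\<Sum>k<n. g (xs ! k))) = 0"
    and "(\<Sum>xs\<in>words n. tensor_power n \<rho> xs * (\<Sum>k<n. g (xs ! k))\<^sup>2)
       = n * (\<Sum>x\<in>UNIV. \<rho> $ x * (g x)\<^sup>2)"
proof (induction n)
  case 0
  case 1 show ?case by simp
  case 2 show ?case by simp
next
  case (Suc n)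
  let ?S = "\<lambda>xs. \<Sum>k<n. g (xs ! k)" and ?p = "tensor_power n \<rho>"
  have p1: "(\<Sum>xs\<in>words n. ?p xs) = 1"
    using tensor_power_word_density[OF \<rho>, of n] by (simp add: word_densities_def)
  case 1
  have "(\<Sum>xs\<in>words (Suc n). tensor_power (Suc n) \<rho> xs * (\<Sum>k<Suc n. g (xs ! k)))
      = (\<Sum>x\<in>UNIV. \<Sum>xs\<in>words n. (\<rho> $ x * g x) * ?p xs + \<rho> $ x * (?p xs * ?S xs))"
    by (simp add: sum_words_Suc tensor_power_Cons sum.lessThan_Suc_shift algebra_simps
        del: sum.lessThan_Suc)
  also have "\<dots> = 0"
    using g by (simp add: sum.distrib Suc.IH(1) p1 flip: sum_distrib_left)
  finally show ?case .
  case 2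
  have "(\<Sum>xs\<in>words (Suc n). tensor_power (Suc n) \<rho> xs * (\<Sum>k<Suc n. g (xs ! k))\<^sup>2)
      = (\<Sum>x\<in>UNIV. \<Sum>xs\<in>words n. (\<rho> $ x * (g x)\<^sup>2) * ?p xs
          + (2 * (\<rho> $ x * g x)) * (?p xs * ?S xs) + \<rho> $ x * (?p xs * (?S xs)\<^sup>2))"
    by (simp add: sum_words_Suc tensor_power_Cons sum.lessThan_Suc_shift algebra_simps power2_sum
        del: sum.lessThan_Suc)
  also have "\<dots> = (\<Sum>x\<in>UNIV. \<rho> $ x * (g x)\<^sup>2) + (\<Sum>x\<in>UNIV. \<rho> $ x) * (n * (\<Sum>x\<in>UNIV. \<rho> $ x * (g x)\<^sup>2))"
    by (simp add: sum.distrib Suc.IH p1 flip: sum_distrib_left sum_distrib_right)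
  also have "\<dots> = Suc n * (\<Sum>x\<in>UNIV. \<rho> $ x * (g x)\<^sup>2)"
    by (simp add: densities_sum[OF \<rho>] algebra_simps)
  finally show ?case .
qed

text \<open>The tangent of \<open>exp\<close> at the mean \<open>?m\<close> lies below
  \<open>exp\<close>, and averaging the tangent gives exactly \<open>exp ?m\<close>.\<close>

lemma exp_jensen:
  fixes p y :: "'b \<Rightarrow> real"
  assumes "\<And>x. x \<in> A \<Longrightarrow> 0 \<le> p x" and "(\<Sum>x\<in>A. p x) = 1"
  shows "exp (\<Sum>x\<in>A. p x * y x) \<le> (\<Sum>x\<in>A. p x * exp (y x))"
proof -
  let ?m = "\<Sum>x\<in>A. p x * y x"
  have "exp ?m = (\<Sum>x\<in>A. p x * (exp ?m * (1 + (y x - ?m))))"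
  proof -
    have "(\<Sum>x\<in>A. p x * (exp ?m * (1 + (y x - ?m))))
        = exp ?m * (1 - ?m) * (\<Sum>x\<in>A. p x) + exp ?m * (\<Sum>x\<in>A. p x * y x)"
      unfolding sum_distrib_left sum.distrib[symmetric] by (rule sum.cong) (auto simp: algebra_simps)
    then show ?thesis using assms(2) by (simp add: algebra_simps)
  qed
  also have "\<dots> \<le> (\<Sum>x\<in>A. p x * exp (y x))"
  proof (intro sum_mono mult_left_mono assms(1))
    fix x
    have "exp ?m * (1 + (y x - ?m)) \<le> exp ?m * exp (y x - ?m)"
      by (intro mult_left_mono exp_ge_add_one_self) auto
    also have "\<dots> = exp (y x)" by (simp flip: exp_add)
    finally show "exp ?m * (1 + (y x - ?m)) \<le> exp (y x)" .
  qed
  finally show ?thesis .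
qed

section \<open>Exponential tilting\<close>

text \<open>The moment generating function at \<open>t\<close> of \<open>ln f\<close> under
  \<open>\<rho>\<close>, for positive \<open>f\<close>.\<close>

definition moment :: "real ^ 'a::finite \<Rightarrow> real ^ 'a \<Rightarrow> real \<Rightarrow> real" where
  "moment \<rho> f t = (\<Sum>x\<in>UNIV. \<rho> $ x * f $ x powr t)"

definition tilt :: "real ^ 'a::finite \<Rightarrow> real ^ 'a \<Rightarrow> real \<Rightarrow> real ^ 'a" where
  "tilt \<rho> f t = (\<chi> x. \<rho> $ x * f $ x powr t / moment \<rho> f t)"

text \<open>For positive \<open>f\<close>, the derivative of \<open>ln (moment \<rho> f t)\<close>
  in \<open>t\<close>. It is given as an expectation because only the tangent inequality below is
  needed.\<close>

definition tilted_log :: "real ^ 'a::finite \<Rightarrow> real ^ 'a \<Rightarrow> real \<Rightarrow> real" where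
  "tilted_log \<rho> f t = (\<Sum>x\<in>UNIV. tilt \<rho> f t $ x * ln (f $ x))"

lemma rate_le:
  assumes "exp E \<le> p" shows "rate n p \<le> ereal (- E / n)"
proof -
  have "0 < p" using assms by (rule less_le_trans[OF exp_gt_zero])
  then have "- ln p \<le> - E" using assms by (simp add: ln_ge_iff)
  then have "1 / real n * - ln p \<le> 1 / real n * - E" by (intro mult_left_mono) auto
  then show ?thesis using \<open>0 < p\<close> by (simp add: rate_def neg_log_def)
qed

context
  fixes \<rho> f :: "real ^ 'a::finite"
  assumes \<rho>: "\<rho> \<in> densities" and f_pos: "\<And>x. 0 < f $ x"
begin

lemma moment_pos: "0 < moment \<rho> f t"
proof -
  obtain x where "\<rho> $ x \<noteq> 0"
    using densities_sum[OF \<rho>] by (metis sum.neutral zero_neq_one)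
  then have "0 < \<rho> $ x * f $ x powr t"
    using densities_nonneg[OF \<rho>, of x] f_pos[of x] by simp
  then show ?thesis
    unfolding moment_def using densities_nonneg[OF \<rho>]
    by (intro sum_pos2[of UNIV x]) auto
qed

lemma moment_0: "moment \<rho> f 0 = 1"
  using f_pos densities_sum[OF \<rho>] by (simp add: moment_def less_imp_neq[THEN not_sym])

lemma tilt_density: "tilt \<rho> f t \<in> densities"
  using densities_nonneg[OF \<rho>] moment_pos[of t]
  by (auto simp: densities_def tilt_def moment_def simp flip: sum_divide_distrib
      intro!: divide_nonneg_nonneg sum_nonneg)

text \<open>Convexity of the log moment in \<open>t\<close>, in supporting-line form: Jensen under
  the density tilted at \<open>b\<close>, where the ratio of the two moments is the expectation of
  \<open>exp ((t - b) * ln f)\<close>.\<close>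

lemma ln_moment_tangent:
  "ln (moment \<rho> f b) + (t - b) * tilted_log \<rho> f b \<le> ln (moment \<rho> f t)"
proof -
  have "exp ((t - b) * tilted_log \<rho> f b) = exp (\<Sum>x\<in>UNIV. tilt \<rho> f b $ x * ((t - b) * ln (f $ x)))"
    by (simp add: tilted_log_def sum_distrib_left mult_ac)
  also have "\<dots> \<le> (\<Sum>x\<in>UNIV. tilt \<rho> f b $ x * exp ((t - b) * ln (f $ x)))"
    by (rule exp_jensen) (auto simp: tilt_density densities_sum densities_nonneg)
  also have "\<dots> = (\<Sum>x\<in>UNIV. \<rho> $ x * f $ x powr t / moment \<rho> f b)"
  proof (rule sum.cong[OF refl])
    fix x
    have "f $ x powr b * exp ((t - b) * ln (f $ x)) = f $ x powr t"
      using f_pos[of x] by (simp add: powr_def algebra_simps flip: exp_add)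
    then show "tilt \<rho> f b $ x * exp ((t - b) * ln (f $ x)) = \<rho> $ x * f $ x powr t / moment \<rho> f b"
      by (simp add: tilt_def)
  qed
  also have "\<dots> = moment \<rho> f t / moment \<rho> f b"
    by (simp add: moment_def sum_divide_distrib)
  finally have "(t - b) * tilted_log \<rho> f b \<le> ln (moment \<rho> f t / moment \<rho> f b)"
    using moment_pos by (simp add: ln_ge_iff)
  then show ?thesis
    using moment_pos[of t] moment_pos[of b] by (simp add: ln_div)
qed

lemma continuous_on_tilted_log: "continuous_on A (tilted_log \<rho> f)"
proof -
  have "moment \<rho> f t \<noteq> 0" "f $ x \<noteq> 0" for t x
    using moment_pos[of t] f_pos[of x] by auto
  then show ?thesis
    unfolding tilted_log_def tilt_def by (auto simp: moment_def intro!: continuous_intros)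
qed

lemma tensor_power_tilt:
  assumes "xs \<in> words n"
  shows "tensor_power n \<rho> xs = tensor_power n (tilt \<rho> f t) xs
       * exp (n * ln (moment \<rho> f t) - t * (\<Sum>k<n. ln (f $ (xs ! k))))"
proof -
  have "\<rho> $ x = tilt \<rho> f t $ x * exp (ln (moment \<rho> f t) - t * ln (f $ x))" for x
    using moment_pos[of t] f_pos[of x] by (simp add: tilt_def powr_def exp_diff)
  then have "(\<Prod>k<n. \<rho> $ (xs ! k))
      = (\<Prod>k<n. tilt \<rho> f t $ (xs ! k) * exp (ln (moment \<rho> f t) - t * ln (f $ (xs ! k))))"
    by (intro prod.cong) auto
  then show ?thesis
    using assms
    by (simp add: tensor_power_word prod.distrib sum_subtractf sum_distrib_left flip: exp_sum)
qed

text \<open>Jensen's inequality under the tilted density, whose log-likelihood ratio to \<open>\<rho>\<close> is affine in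
  the sum of the \<open>ln f\<close>; the fluctuation of that sum costs only order \<open>sqrt n\<close>.\<close>

lemma test_prob_tilt_lower_bound:
  fixes T :: "'a list \<Rightarrow> real" and t c :: real
  defines "d \<equiv> tilted_log \<rho> f t"
  defines "V \<equiv> \<Sum>x\<in>UNIV. tilt \<rho> f t $ x * (ln (f $ x) - d)\<^sup>2"
  assumes n: "n > 0" and T: "\<And>xs. xs \<in> words n \<Longrightarrow> min 1 (exp c * (\<Prod>k<n. f $ (xs ! k))) \<le> T xs"
  shows "exp (n * (ln (moment \<rho> f t) - t * d) + min 0 (c + n * d) - sqrt n * (1 + V) / 2)
    \<le> test_prob n (tensor_power n \<rho>) T"
proof -
  define P where "P = tensor_power n (tilt \<rho> f t)"
  define G where "G xs = (\<Sum>k<n. ln (f $ (xs ! k)))" for xs :: "'a list"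
  define Y where "Y xs = (\<Sum>k<n. ln (f $ (xs ! k)) - d)" for xs :: "'a list"
  let ?L = "ln (moment \<rho> f t)"
  have P_nonneg: "0 \<le> P xs" and P_sum: "(\<Sum>xs\<in>words n. P xs) = 1" for xs
    using tensor_power_word_density[OF tilt_density, of n t] by (auto simp: P_def word_densities_def)
  have "(\<Sum>x\<in>UNIV. tilt \<rho> f t $ x * (ln (f $ x) - d)) = 0"
    by (simp add: right_diff_distrib sum_subtractf d_def tilted_log_def densities_sum tilt_density
        flip: sum_distrib_right)
  note moments = tensor_power_moments[OF tilt_density this, of n, folded P_def Y_def V_def]
  have Y: "G xs = n * d + Y xs" for xs
    by (simp add: G_def Y_def sum_subtractf)
  \<comment> \<open>\<open>min 0\<close> is 1-Lipschitz, so the fluctuation \<open>Y\<close> costs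
    at most \<open>\<bar>Y\<bar>\<close>. Trading this for a square makes the bound integrable from
    the two moments alone; the weight \<open>sqrt n\<close> balances the two terms because
    \<open>Y\<close> has variance \<open>n * V\<close>.\<close>
  have pointwise: "n * (?L - t * d) + min 0 (c + n * d) - sqrt n / 2 - t * Y xs - (Y xs)\<^sup>2 / (2 * sqrt n)
      \<le> n * ?L - t * G xs + min 0 (c + G xs)" for xs
  proof -
    have "0 \<le> (\<bar>Y xs\<bar> - sqrt n)\<^sup>2" by simp
    then have "2 * sqrt n * \<bar>Y xs\<bar> \<le> (Y xs)\<^sup>2 + sqrt n * sqrt n"
      by (simp add: power2_diff algebra_simps)
    then have "\<bar>Y xs\<bar> \<le> (Y xs)\<^sup>2 / (2 * sqrt n) + sqrt n / 2"
      using n by (simp add: field_simps)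
    moreover have "min 0 (c + n * d) - \<bar>Y xs\<bar> \<le> min 0 (c + G xs)"
      by (auto simp: Y min_def)
    ultimately show ?thesis by (simp add: Y algebra_simps)
  qed
  have "n * (?L - t * d) + min 0 (c + n * d) - sqrt n * (1 + V) / 2
      = (n * (?L - t * d) + min 0 (c + n * d) - sqrt n / 2) * (\<Sum>xs\<in>words n. P xs)
        - t * (\<Sum>xs\<in>words n. P xs * Y xs) - (\<Sum>xs\<in>words n. P xs * (Y xs)\<^sup>2) / (2 * sqrt n)"
    using n unfolding moments P_sum by (simp add: field_simps)
  also have "\<dots> = (\<Sum>xs\<in>words n. P xs * (n * (?L - t * d) + min 0 (c + n * d) - sqrt n / 2
      - t * Y xs - (Y xs)\<^sup>2 / (2 * sqrt n)))"
    unfolding sum_distrib_left sum_divide_distrib sum_subtractf[symmetric]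
    by (rule sum.cong) (auto simp: algebra_simps)
  also have "\<dots> \<le> (\<Sum>xs\<in>words n. P xs * (n * ?L - t * G xs + min 0 (c + G xs)))"
    by (intro sum_mono mult_left_mono pointwise P_nonneg)
  finally have "exp (n * (?L - t * d) + min 0 (c + n * d) - sqrt n * (1 + V) / 2)
      \<le> exp (\<Sum>xs\<in>words n. P xs * (n * ?L - t * G xs + min 0 (c + G xs)))"
    by simp
  also have "\<dots> \<le> (\<Sum>xs\<in>words n. P xs * exp (n * ?L - t * G xs + min 0 (c + G xs)))"
    by (rule exp_jensen) (simp_all add: P_nonneg P_sum)
  also have "\<dots> \<le> test_prob n (tensor_power n \<rho>) T"
    unfolding test_prob_def
  proof (rule sum_mono)
    fix xs :: "'a list" assume xs: "xs \<in> words n"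
    have "exp (min 0 (c + G xs)) = min 1 (exp c * (\<Prod>k<n. f $ (xs ! k)))"
    proof -
      have "exp (c + G xs) = exp c * (\<Prod>k<n. f $ (xs ! k))"
        by (simp add: G_def exp_sum exp_add f_pos)
      moreover have "exp (min 0 y) = min 1 (exp y)" for y :: real
        by (simp add: min_def)
      ultimately show ?thesis by simp
    qed
    then have "P xs * exp (n * ?L - t * G xs + min 0 (c + G xs))
        = tensor_power n \<rho> xs * min 1 (exp c * (\<Prod>k<n. f $ (xs ! k)))"
      using xs by (simp add: tensor_power_tilt[of xs n t] P_def G_def exp_add)
    also have "\<dots> \<le> tensor_power n \<rho> xs * T xs"
      using tensor_power_word_density[OF \<rho>, of n]
      by (intro mult_left_mono T xs) (auto simp: word_densities_def)
    finally show "P xs * exp (n * ?L - t * G xs + min 0 (c + G xs)) \<le> tensor_power n \<rho> xs * T xs" .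
  qed
  finally show ?thesis .
qed

text \<open>The factor \<open>1 / (n + 1)\<close> leaves room for averaging over
  \<open>n + 1\<close> e-variables and costs only \<open>ln (n + 1) / n\<close> in the rate. Tilting
  by \<open>t\<close> gives the exponent \<open>t d - L + max 0 (r - d)\<close>, which a suitable
  \<open>t\<close> reduces to \<open>t r - L\<close>.\<close>

lemma limsup_rate_le:
  fixes T :: "nat \<Rightarrow> 'a list \<Rightarrow> real" and r v :: real
  assumes T: "\<forall>\<^sub>F n in sequentially. \<forall>xs\<in>words n.
      min 1 (exp (- (n * r)) / (n + 1) * (\<Prod>k<n. f $ (xs ! k))) \<le> T n xs"
    and v: "\<And>t. 0 \<le> t \<Longrightarrow> t \<le> 1 \<Longrightarrow> t * r - ln (moment \<rho> f t) \<le> v"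
  shows "limsup (\<lambda>n. rate n (test_prob n (tensor_power n \<rho>) (T n))) \<le> ereal v"
proof -
  \<comment> \<open>Such a \<open>t\<close> maximises the concave function
    \<open>t r - ln (moment \<rho> f t)\<close> on the unit interval, whose slope is
    \<open>r - tilted_log \<rho> f t\<close>: an endpoint if the slope keeps its sign there,
    otherwise a zero of the slope.\<close>
  have "\<exists>t. 0 \<le> t \<and> t \<le> 1 \<and>
      t * tilted_log \<rho> f t + max 0 (r - tilted_log \<rho> f t) = t * r"
  proof -
    consider "r \<le> tilted_log \<rho> f 0" | "tilted_log \<rho> f 1 \<le> r"
      | "tilted_log \<rho> f 0 \<le> r" "r \<le> tilted_log \<rho> f 1" by linarith
    then show ?thesis
    proof cases
      case 1 then show ?thesis by (intro exI[of _ 0]) auto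
    next
      case 2 then show ?thesis by (intro exI[of _ 1]) auto
    next
      case 3
      then obtain t where "0 \<le> t" "t \<le> 1" "tilted_log \<rho> f t = r"
        using IVT'[of "tilted_log \<rho> f" 0 r 1] continuous_on_tilted_log by auto
      then show ?thesis by auto
    qed
  qed
  then obtain t where t: "0 \<le> t" "t \<le> 1"
    "t * tilted_log \<rho> f t + max 0 (r - tilted_log \<rho> f t) = t * r" by blast
  define d where "d = tilted_log \<rho> f t"
  define V where "V = (\<Sum>x\<in>UNIV. tilt \<rho> f t $ x * (ln (f $ x) - d)\<^sup>2)"
  define L where "L = ln (moment \<rho> f t)"
  \<comment> \<open>The exponent of \<open>test_prob_tilt_lower_bound\<close> with
    \<open>c = - (n r) - ln (n + 1)\<close>, divided by \<open>- n\<close>.\<close>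
  define B where "B n = t * d - L + max 0 (r - d + ln (real n + 1) / n) + (1 + V) / 2 / sqrt n" for n :: nat
  have "\<forall>\<^sub>F n in sequentially. rate n (test_prob n (tensor_power n \<rho>) (T n)) \<le> ereal (B n)"
    using T eventually_gt_at_top[of 0]
  proof eventually_elim
    case (elim n)
    define c where "c = - (n * r) - ln (real n + 1)"
    have "exp c = exp (- (n * r)) / (n + 1)"
      by (simp add: c_def exp_diff)
    then have "exp (n * (L - t * d) + min 0 (c + n * d) - sqrt n * (1 + V) / 2)
        \<le> test_prob n (tensor_power n \<rho>) (T n)"
      unfolding L_def d_def V_def using elim by (intro test_prob_tilt_lower_bound) auto
    from rate_le[OF this, of n]
    have "rate n (test_prob n (tensor_power n \<rho>) (T n))
      \<le> ereal (- (n * (L - t * d) + min 0 (c + n * d) - sqrt n * (1 + V) / 2) / n)" .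
    also have "- (n * (L - t * d) + min 0 (c + n * d) - sqrt n * (1 + V) / 2) / n = B n"
    proof -
      define z where "z = r - d + ln (real n + 1) / n"
      have "c + n * d = - (n * z)"
        using elim by (simp add: c_def z_def field_simps)
      then have "- min 0 (c + n * d) / n = max 0 z"
        using elim by (simp add: min_def max_def zero_le_mult_iff mult_le_0_iff)
      moreover have "sqrt n * (1 + V) / 2 / n = (1 + V) / 2 / sqrt n"
      proof -
        have "sqrt n * (1 + V) / 2 / n = (1 + V) / 2 * (sqrt n / n)"
          by simp
        also have "sqrt n / n = inverse (sqrt n)"
          by (rule sqrt_divide_self_eq) simp
        finally show ?thesis
          by (simp only: divide_inverse)
      qed
      moreover have "- (n * (L - t * d) + min 0 (c + n * d) - sqrt n * (1 + V) / 2) / n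
        = (t * d - L) + - min 0 (c + n * d) / n + sqrt n * (1 + V) / 2 / n"
        using elim by (simp add: field_simps)
      ultimately show ?thesis by (simp add: B_def z_def)
    qed
    finally show ?case .
  qed
  then have "limsup (\<lambda>n. rate n (test_prob n (tensor_power n \<rho>) (T n))) \<le> limsup (\<lambda>n. ereal (B n))"
    by (rule Limsup_mono)
  also have "limsup (\<lambda>n. ereal (B n)) = ereal (t * r - L)"
  proof (rule lim_imp_Limsup)
    have "(\<lambda>n. ln (real n + 1) / n) \<longlonglongrightarrow> 0" by real_asymp
    moreover have "(\<lambda>n. (1 + V) / 2 / sqrt (real n)) \<longlonglongrightarrow> 0" by real_asymp
    ultimately have "B \<longlonglongrightarrow> t * d - L + max 0 (r - d + 0) + 0"
      unfolding B_def by (intro tendsto_intros)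
    then show "(\<lambda>n. ereal (B n)) \<longlonglongrightarrow> ereal (t * r - L)"
      using t(3) by (simp add: d_def algebra_simps)
  qed simp
  also have "ereal (t * r - L) \<le> ereal v"
    using v[OF t(1,2)] by (simp add: L_def)
  finally show ?thesis .
qed

end

section \<open>A minimax argument over a compact interval\<close>

text \<open>Near each \<open>t\<close> a pointwise good \<open>f\<close> stays good, by its tangent
  bound; two functions good on adjacent intervals are merged into one by convexity in
  \<open>f\<close>. Bisection then reaches the whole interval, with no compactness of
  \<open>F\<close>.\<close>

lemma minimax_interval:
  fixes u :: "'b::real_vector \<Rightarrow> real \<Rightarrow> real" and v lo hi :: real
  assumes "lo \<le> hi" and F: "convex F"
    and convex: "\<And>f g l t. \<lbrakk>f \<in> F; g \<in> F; 0 \<le> l; l \<le> 1; lo \<le> t; t \<le> hi\<rbrakk>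
      \<Longrightarrow> u (l *\<^sub>R f + (1 - l) *\<^sub>R g) t \<le> l * u f t + (1 - l) * u g t"
    and tangent: "\<And>f b. \<lbrakk>f \<in> F; lo \<le> b; b \<le> hi\<rbrakk> \<Longrightarrow> \<exists>m. \<forall>t. u f t \<le> u f b + m * (t - b)"
    and pointwise: "\<And>t. \<lbrakk>lo \<le> t; t \<le> hi\<rbrakk> \<Longrightarrow> \<exists>f\<in>F. u f t < v"
  shows "\<exists>f\<in>F. \<forall>t. lo \<le> t \<longrightarrow> t \<le> hi \<longrightarrow> u f t < v"
proof -
  \<comment> \<open>Only points of the interval from \<open>lo\<close> to \<open>hi\<close> are
    tested, since the Bolzano principle also asks about intervals that stick out of it.\<close>
  define Q where "Q a b = (\<exists>f\<in>F. \<forall>t. a \<le> t \<longrightarrow> t \<le> b \<longrightarrow> lo \<le> t \<longrightarrow> t \<le> hi \<longrightarrow> u f t < v)" for a b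
  have "Q lo hi"
    using \<open>lo \<le> hi\<close>
  proof (induction rule: Bolzano)
    case (trans a b c)
    show ?case
    proof (cases "lo \<le> b \<and> b \<le> hi")
      \<comment> \<open>With \<open>b\<close> outside the range, one of the two adjacent intervals
        already contains all relevant points.\<close>
      case False
      then show ?thesis using trans unfolding Q_def by (meson linorder_le_cases order_trans)
    next
      case True
      obtain f g where f: "f \<in> F" "\<And>t. \<lbrakk>a \<le> t; t \<le> b; lo \<le> t; t \<le> hi\<rbrakk> \<Longrightarrow> u f t < v"
        and g: "g \<in> F" "\<And>t. \<lbrakk>b \<le> t; t \<le> c; lo \<le> t; t \<le> hi\<rbrakk> \<Longrightarrow> u g t < v"
        using trans unfolding Q_def by blast
      have fb: "u f b < v" and gb: "u g b < v" using f g trans True by auto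
      obtain m k where m: "\<And>t. u f t \<le> u f b + m * (t - b)" and k: "\<And>t. u g t \<le> u g b + k * (t - b)"
        using tangent f(1) g(1) True by meson
      \<comment> \<open>A tangent of \<open>u f\<close> that does not rise to the right keeps
        \<open>f\<close> good beyond \<open>b\<close>; one of \<open>u g\<close> that does not rise
        to the left keeps \<open>g\<close> good before \<open>b\<close>. Otherwise the slopes have
        opposite signs and can be cancelled.\<close>
      consider "m \<le> 0" | "0 \<le> k" | "0 < m" "k < 0" by linarith
      then show ?thesis
      proof cases
        case 1
        have "u f t < v" if "a \<le> t" "t \<le> c" "lo \<le> t" "t \<le> hi" for t
        proof (cases "t \<le> b")
          case False
          then have "m * (t - b) \<le> 0" using 1 by (simp add: mult_le_0_iff)
          then show ?thesis using m[of t] fb by linarith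
        qed (use f that in auto)
        then show ?thesis unfolding Q_def using f by blast
      next
        case 2
        have "u g t < v" if "a \<le> t" "t \<le> c" "lo \<le> t" "t \<le> hi" for t
        proof (cases "b \<le> t")
          case False
          then have "k * (t - b) \<le> 0" using 2 by (simp add: mult_le_0_iff)
          then show ?thesis using k[of t] gb by linarith
        qed (use g that in auto)
        then show ?thesis unfolding Q_def using g by blast
      next
        \<comment> \<open>Weights for which the convex combination of the two tangents is flat.\<close>
        case 3
        define l where "l = - k / (m - k)"
        have l: "0 < l" "l < 1" "l * m + (1 - l) * k = 0"
          using 3 by (auto simp: l_def field_simps)
        have "u (l *\<^sub>R f + (1 - l) *\<^sub>R g) t < v" if t: "lo \<le> t" "t \<le> hi" for t
        proof -
          have "u (l *\<^sub>R f + (1 - l) *\<^sub>R g) t \<le> l * u f t + (1 - l) * u g t"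
            using convex f g l t by simp
          also have "\<dots> \<le> l * (u f b + m * (t - b)) + (1 - l) * (u g b + k * (t - b))"
            using m[of t] k[of t] l by (intro add_mono mult_left_mono) auto
          also have "\<dots> = l * u f b + (1 - l) * u g b + (l * m + (1 - l) * k) * (t - b)"
            by (simp add: algebra_simps)
          also have "\<dots> < l * v + (1 - l) * v"
            using fb gb l by (simp add: add_strict_mono)
          finally show ?thesis by (simp add: algebra_simps)
        qed
        moreover have "l *\<^sub>R f + (1 - l) *\<^sub>R g \<in> F"
          using convexD[OF F f(1) g(1), of l "1 - l"] l by simp
        ultimately show ?thesis unfolding Q_def by blast
      qed
    qed
  next
    case (local x)
    then obtain f where f: "f \<in> F" "u f x < v" using pointwise by blast
    obtain m where m: "\<And>t. u f t \<le> u f x + m * (t - x)" using tangent f(1) local by meson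
    \<comment> \<open>Within this distance the tangent cannot consume the gap
      \<open>v - u f x\<close>; the \<open>+ 1\<close> covers slope zero.\<close>
    define d where "d = (v - u f x) / (\<bar>m\<bar> + 1)"
    have "d > 0" using f by (simp add: d_def)
    moreover have "Q a b" if "a \<le> x" "x \<le> b" "b - a < d" for a b
      unfolding Q_def
    proof (intro bexI[OF _ f(1)] allI impI)
      fix t assume "a \<le> t" "t \<le> b"
      then have "\<bar>t - x\<bar> < d" using that by linarith
      then have "\<bar>t - x\<bar> * (\<bar>m\<bar> + 1) < v - u f x"
        by (simp add: d_def pos_less_divide_eq)
      moreover have "m * (t - x) \<le> \<bar>t - x\<bar> * (\<bar>m\<bar> + 1)"
      proof -
        have "m * (t - x) \<le> \<bar>m\<bar> * \<bar>t - x\<bar>"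
          by (metis abs_ge_self abs_mult)
        then show ?thesis by (simp add: algebra_simps)
      qed
      ultimately show "u f t < v" using m[of t] by linarith
    qed
    ultimately show ?case by blast
  qed
  then show ?thesis unfolding Q_def by blast
qed

section \<open>E-variables and the concavity of their log moments\<close>

text \<open>Strict positivity keeps \<open>ln (f $ x)\<close> meaningful and all moments positive,
  as tilting requires.\<close>

definition e_variables :: "(real ^ 'a::finite) set \<Rightarrow> (real ^ 'a) set" where
  "e_variables C = {f. (\<forall>x. 0 < f $ x) \<and> (\<forall>\<sigma>\<in>C. (\<Sum>x\<in>UNIV. \<sigma> $ x * f $ x) \<le> 1)}"

lemma convex_e_variables: "convex (e_variables C)"
proof (rule convexI)
  fix f g :: "real ^ 'a" and l m :: real
  assume fg: "f \<in> e_variables C" "g \<in> e_variables C" and lm: "0 \<le> l" "0 \<le> m" "l + m = 1"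
  have "0 < l * f $ x + m * g $ x" for x
    using fg lm by (cases "l = 0") (auto simp: e_variables_def less_imp_le intro!: add_pos_nonneg mult_nonneg_nonneg)
  moreover have "(\<Sum>x\<in>UNIV. \<sigma> $ x * (l * f $ x + m * g $ x)) \<le> 1" if "\<sigma> \<in> C" for \<sigma>
  proof -
    have "(\<Sum>x\<in>UNIV. \<sigma> $ x * (l * f $ x + m * g $ x))
        = l * (\<Sum>x\<in>UNIV. \<sigma> $ x * f $ x) + m * (\<Sum>x\<in>UNIV. \<sigma> $ x * g $ x)"
      by (simp add: sum_distrib_left sum.distrib algebra_simps)
    also have "\<dots> \<le> l * 1 + m * 1"
      using fg lm that by (intro add_mono mult_left_mono) (auto simp: e_variables_def)
    finally show ?thesis using lm by simp
  qed
  ultimately show "l *\<^sub>R f + m *\<^sub>R g \<in> e_variables C"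
    by (simp add: e_variables_def)
qed

lemma const_1_e_variable: "C \<subseteq> densities \<Longrightarrow> (\<chi> x. 1) \<in> e_variables C"
  by (auto simp: e_variables_def densities_def)

lemma ln_two_point_concave:
  fixes a b l :: real
  assumes "0 < a" "0 < b" "0 \<le> l" "l \<le> 1"
  shows "l * ln a + (1 - l) * ln b \<le> ln (l * a + (1 - l) * b)"
  using concave_onD[OF ln_concave, of "1 - l" a b] assms by simp

text \<open>The weighted AM-GM inequality bounds \<open>(x / z) powr t\<close> by its tangent at
  \<open>x = z\<close>; with \<open>z\<close> the mean of \<open>a\<close> and \<open>b\<close>, the
  tangents average to \<open>z powr t\<close>.\<close>

lemma powr_two_point_concave:
  fixes a b l t :: real
  assumes "0 < a" "0 < b" "0 \<le> l" "l \<le> 1" "0 \<le> t" "t \<le> 1"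
  shows "l * a powr t + (1 - l) * b powr t \<le> (l * a + (1 - l) * b) powr t"
proof -
  define z where "z = l * a + (1 - l) * b"
  have z: "0 < z"
    using assms by (cases "l = 0") (auto simp: z_def intro!: add_pos_nonneg)
  have *: "x powr t \<le> z powr t * (t * (x / z) + (1 - t))" if "0 < x" for x
  proof -
    have "(x / z) powr t * 1 powr (1 - t) \<le> t * (x / z) + (1 - t) * 1"
      using assms that z by (intro Youngs_inequality_0) auto
    then have "z powr t * (x / z) powr t \<le> z powr t * (t * (x / z) + (1 - t))"
      by (intro mult_left_mono) auto
    then show ?thesis using that z by (simp add: powr_divide)
  qed
  have "l * a powr t + (1 - l) * b powr t
      \<le> l * (z powr t * (t * (a / z) + (1 - t))) + (1 - l) * (z powr t * (t * (b / z) + (1 - t)))"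
    using assms by (intro add_mono mult_left_mono *) auto
  also have "\<dots> = z powr t * (t * ((l * a + (1 - l) * b) / z) + (1 - t))"
    using z by (simp add: field_simps)
  also have "\<dots> = z powr t"
    using z by (simp flip: z_def)
  finally show ?thesis by (simp add: z_def)
qed

text \<open>Concavity of \<open>ln\<close>, followed by its monotonicity and the termwise concavity
  of \<open>powr t\<close>; the latter is where \<open>t \<le> 1\<close> enters.\<close>

lemma ln_moment_concave:
  assumes \<rho>: "\<rho> \<in> densities" and f: "\<And>x. 0 < f $ x" and g: "\<And>x. 0 < g $ x"
    and l: "0 \<le> l" "l \<le> 1" and t: "0 \<le> t" "t \<le> 1"
  shows "l * ln (moment \<rho> f t) + (1 - l) * ln (moment \<rho> g t)
      \<le> ln (moment \<rho> (l *\<^sub>R f + (1 - l) *\<^sub>R g) t)"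
proof -
  have pos: "0 < l * moment \<rho> f t + (1 - l) * moment \<rho> g t"
    using l moment_pos[OF \<rho> f, of t] moment_pos[OF \<rho> g, of t]
    by (cases "l = 0") (auto intro!: add_pos_nonneg)
  have "l * ln (moment \<rho> f t) + (1 - l) * ln (moment \<rho> g t)
      \<le> ln (l * moment \<rho> f t + (1 - l) * moment \<rho> g t)"
    using moment_pos[OF \<rho> f] moment_pos[OF \<rho> g] l by (intro ln_two_point_concave)
  also have "\<dots> \<le> ln (moment \<rho> (l *\<^sub>R f + (1 - l) *\<^sub>R g) t)"
  proof -
    have "l * moment \<rho> f t + (1 - l) * moment \<rho> g t
        = (\<Sum>x\<in>UNIV. \<rho> $ x * (l * f $ x powr t + (1 - l) * g $ x powr t))"
      by (simp add: moment_def sum_distrib_left algebra_simps flip: sum.distrib)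
    also have "\<dots> \<le> moment \<rho> (l *\<^sub>R f + (1 - l) *\<^sub>R g) t"
      unfolding moment_def
      using powr_two_point_concave[OF f g l t]
      by (intro sum_mono mult_left_mono) (auto simp: densities_nonneg[OF \<rho>])
    finally show ?thesis using pos by simp
  qed
  finally show ?thesis .
qed

text \<open>The minimax argument for the payoff \<open>t r - ln (moment \<rho> f t)\<close>, which
  is convex in \<open>f\<close> and has the tangent slope \<open>r - tilted_log \<rho> f b\<close>
  in \<open>t\<close>.\<close>

lemma uniform_e_variable:
  assumes \<rho>: "\<rho> \<in> densities"
    and pointwise: "\<And>t. \<lbrakk>0 \<le> t; t \<le> 1\<rbrakk> \<Longrightarrow> \<exists>f\<in>e_variables C. t * r - ln (moment \<rho> f t) < v"
  shows "\<exists>f\<in>e_variables C. \<forall>t. 0 \<le> t \<longrightarrow> t \<le> 1 \<longrightarrow> t * r - ln (moment \<rho> f t) < v"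
proof (rule minimax_interval)
  show "t * r - ln (moment \<rho> (l *\<^sub>R f + (1 - l) *\<^sub>R g) t)
      \<le> l * (t * r - ln (moment \<rho> f t)) + (1 - l) * (t * r - ln (moment \<rho> g t))"
    if "f \<in> e_variables C" "g \<in> e_variables C" "0 \<le> l" "l \<le> 1" "0 \<le> t" "t \<le> 1" for f g l t
    using ln_moment_concave[OF \<rho>, of f g l t] that by (simp add: e_variables_def algebra_simps)
  show "\<exists>m. \<forall>t. t * r - ln (moment \<rho> f t) \<le> b * r - ln (moment \<rho> f b) + m * (t - b)"
    if "f \<in> e_variables C" for f b
  proof (intro exI allI)
    fix t
    show "t * r - ln (moment \<rho> f t)
        \<le> b * r - ln (moment \<rho> f b) + (r - tilted_log \<rho> f b) * (t - b)"
      using ln_moment_tangent[OF \<rho>, of f b t] that by (simp add: e_variables_def algebra_simps)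
  qed
qed (use convex_e_variables pointwise in auto)

section \<open>Optimal alternatives and their e-variables\<close>

text \<open>For densities with \<open>supp \<rho> \<subseteq> supp \<sigma>\<close> and \<alpha> > 1
  this is the exponential of \<alpha> - 1 times the Renyi divergence.\<close>

definition renyi_sum :: "real \<Rightarrow> real ^ 'a::finite \<Rightarrow> real ^ 'a \<Rightarrow> real" where
  "renyi_sum \<alpha> \<rho> \<sigma> = (\<Sum>x\<in>supp \<rho>. (\<rho> $ x) powr \<alpha> * (\<sigma> $ x) powr (1 - \<alpha>))"

lemma renyi_div_eq:
  "supp \<rho> \<subseteq> supp \<sigma> \<Longrightarrow> renyi_div \<alpha> \<rho> \<sigma> = ereal (1 / (\<alpha> - 1) * ln (renyi_sum \<alpha> \<rho> \<sigma>))"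
  by (simp add: renyi_div_def renyi_sum_def)

lemma supp_nonempty: "\<rho> \<in> densities \<Longrightarrow> supp \<rho> \<noteq> {}"
  unfolding supp_def densities_def by (metis (mono_tags, lifting) empty_Collect_eq mem_Collect_eq sum.neutral zero_neq_one)

lemma renyi_sum_pos:
  assumes "\<rho> \<in> densities" "\<sigma> \<in> densities" "supp \<rho> \<subseteq> supp \<sigma>"
  shows "0 < renyi_sum \<alpha> \<rho> \<sigma>"
  unfolding renyi_sum_def
proof (rule sum_pos)
  show "0 < \<rho> $ x powr \<alpha> * \<sigma> $ x powr (1 - \<alpha>)" if "x \<in> supp \<rho>" for x
    using that assms(3) by (auto simp: supp_def)
qed (simp_all add: supp_nonempty assms)

text \<open>The midpoint of two densities has the union of their supports. Contraposed: if no member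
  of \<open>C\<close> covers \<open>A\<close>, then some point of \<open>A\<close> has mass zero
  under all of \<open>C\<close>.\<close>

lemma common_support:
  fixes C :: "(real ^ 'a::finite) set"
  assumes C: "convex C" "C \<subseteq> densities" "C \<noteq> {}"
    and "finite A" and "\<And>x. x \<in> A \<Longrightarrow> \<exists>\<sigma>\<in>C. \<sigma> $ x \<noteq> 0"
  shows "\<exists>\<sigma>\<in>C. A \<subseteq> supp \<sigma>"
  using assms(4,5)
proof (induction A)
  case empty
  then show ?case using C by auto
next
  case (insert a A)
  then obtain \<sigma> \<tau> where \<sigma>: "\<sigma> \<in> C" "A \<subseteq> supp \<sigma>" and \<tau>: "\<tau> \<in> C" "\<tau> $ a \<noteq> 0"
    by blast
  let ?m = "(1/2) *\<^sub>R \<sigma> + (1/2) *\<^sub>R \<tau>"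
  have "0 \<le> \<sigma> $ x" "0 \<le> \<tau> $ x" for x
    using C \<sigma> \<tau> by (auto intro: densities_nonneg)
  then have "?m $ x = 0 \<longleftrightarrow> \<sigma> $ x = 0 \<and> \<tau> $ x = 0" for x
    by (simp add: add_nonneg_eq_0_iff)
  then have "insert a A \<subseteq> supp ?m"
    using \<sigma> \<tau> by (auto simp: supp_def)
  moreover have "?m \<in> C"
    using convexD[OF C(1) \<sigma>(1) \<tau>(1), of "1/2" "1/2"] by simp
  ultimately show ?case by blast
qed

text \<open>The stationarity condition of a minimiser of the Renyi sum over \<open>C\<close> says that the density
  ratio is an e-variable up to normalisation.\<close>

lemma renyi_sum_minimizer:
  fixes C :: "(real ^ 'a::finite) set"
  assumes C: "convex C" "compact C" "C \<subseteq> densities" and \<rho>: "\<rho> \<in> densities"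
    and \<sigma>0: "\<sigma>0 \<in> C" "supp \<rho> \<subseteq> supp \<sigma>0" and \<alpha>: "1 < \<alpha>"
  obtains \<sigma> where "\<sigma> \<in> C" "supp \<rho> \<subseteq> supp \<sigma>"
    "\<And>\<tau>. \<tau> \<in> C \<Longrightarrow> (\<Sum>x\<in>supp \<rho>. \<tau> $ x * ((\<rho> $ x) powr \<alpha> * (\<sigma> $ x) powr (- \<alpha>))) \<le> renyi_sum \<alpha> \<rho> \<sigma>"
proof -
  define q where "q = renyi_sum \<alpha> \<rho> \<sigma>0"
  have \<rho>_pos: "0 < \<rho> $ x" if "x \<in> supp \<rho>" for x
    using that densities_pos_iff[OF \<rho>] by blast
  have C_pos: "0 < \<sigma> $ x" if "\<sigma> \<in> C" "x \<in> supp \<sigma>" for \<sigma> x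
    using that C densities_pos_iff by blast
  have "0 < q"
    unfolding q_def using renyi_sum_pos \<rho> \<sigma>0 C by blast
  \<comment> \<open>The value of \<open>\<sigma> $ x\<close> at which the summand at
    \<open>x\<close> alone equals \<open>q\<close>; as the exponent \<open>1 - \<alpha>\<close> is
    negative, a Renyi sum of at most \<open>q\<close> forces \<open>\<sigma> $ x\<close> to be at
    least this.\<close>
  define c where "c x = (q / (\<rho> $ x) powr \<alpha>) powr (1 / (1 - \<alpha>))" for x
  have c_pos: "0 < c x" if "x \<in> supp \<rho>" for x
    using \<rho>_pos[OF that] \<open>0 < q\<close> by (simp add: c_def)
  \<comment> \<open>A minimum is sought on \<open>K\<close>, away from zero: because
    \<open>0 powr (1 - \<alpha>)\<close> is 0, the Renyi sum drops instead of diverging when a mass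
    on \<open>supp \<rho>\<close> vanishes.\<close>
  define K where "K = C \<inter> {\<sigma>. \<forall>x\<in>supp \<rho>. c x \<le> \<sigma> $ x}"
  have sublevel: "\<sigma> \<in> K" if \<sigma>: "\<sigma> \<in> C" "supp \<rho> \<subseteq> supp \<sigma>" "renyi_sum \<alpha> \<rho> \<sigma> \<le> q" for \<sigma>
  proof -
    have "c x \<le> \<sigma> $ x" if x: "x \<in> supp \<rho>" for x
    proof -
      have pos: "0 < \<sigma> $ x" using x \<sigma> C_pos by blast
      have "(\<rho> $ x) powr \<alpha> * (\<sigma> $ x) powr (1 - \<alpha>) \<le> renyi_sum \<alpha> \<rho> \<sigma>"
        unfolding renyi_sum_def by (rule member_le_sum[OF x]) auto
      then have "(\<sigma> $ x) powr (1 - \<alpha>) \<le> q / (\<rho> $ x) powr \<alpha>"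
        using \<sigma>(3) \<rho>_pos[OF x] by (simp add: field_simps)
      then have "(q / (\<rho> $ x) powr \<alpha>) powr (1 / (1 - \<alpha>)) \<le> ((\<sigma> $ x) powr (1 - \<alpha>)) powr (1 / (1 - \<alpha>))"
        using \<alpha> pos by (intro powr_mono2') auto
      then show ?thesis using \<alpha> pos by (simp add: c_def powr_powr)
    qed
    then show ?thesis using \<sigma> by (simp add: K_def)
  qed
  have "closed (\<Inter>x\<in>supp \<rho>. {\<sigma>::real ^ 'a. c x \<le> \<sigma> $ x})"
    by (intro closed_INT ballI closed_Collect_le continuous_intros)
  also have "(\<Inter>x\<in>supp \<rho>. {\<sigma>::real ^ 'a. c x \<le> \<sigma> $ x}) = {\<sigma>. \<forall>x\<in>supp \<rho>. c x \<le> \<sigma> $ x}"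
    by auto
  finally have "compact K"
    unfolding K_def using C by (intro compact_Int_closed)
  moreover have "K \<noteq> {}" using sublevel \<sigma>0 by (auto simp: q_def)
  moreover have "continuous_on K (renyi_sum \<alpha> \<rho>)"
    unfolding renyi_sum_def using c_pos
    by (intro continuous_intros) (fastforce simp: K_def)
  ultimately have "\<exists>\<sigma>\<in>K. \<forall>\<tau>\<in>K. renyi_sum \<alpha> \<rho> \<sigma> \<le> renyi_sum \<alpha> \<rho> \<tau>"
    by (rule continuous_attains_inf)
  then obtain \<sigma> where \<sigma>: "\<sigma> \<in> K" "\<And>\<tau>. \<tau> \<in> K \<Longrightarrow> renyi_sum \<alpha> \<rho> \<sigma> \<le> renyi_sum \<alpha> \<rho> \<tau>"
    by blast
  have \<sigma>_C: "\<sigma> \<in> C" using \<sigma> by (simp add: K_def)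
  have \<sigma>_pos: "0 < \<sigma> $ x" if "x \<in> supp \<rho>" for x
    using \<sigma>(1) c_pos[OF that] that by (auto simp: K_def intro: less_le_trans)
  then have \<sigma>_supp: "supp \<rho> \<subseteq> supp \<sigma>" by (force simp: supp_def)
  have minimal: "renyi_sum \<alpha> \<rho> \<sigma> \<le> renyi_sum \<alpha> \<rho> \<tau>" if "\<tau> \<in> C" "supp \<rho> \<subseteq> supp \<tau>" for \<tau>
  proof (cases "renyi_sum \<alpha> \<rho> \<tau> \<le> q")
    case True
    then show ?thesis using \<sigma>(2) sublevel that by blast
  next
    case False
    then show ?thesis using \<sigma>(2)[OF sublevel[OF \<sigma>0]] by (simp add: q_def)
  qed
  have "(\<Sum>x\<in>supp \<rho>. \<tau> $ x * ((\<rho> $ x) powr \<alpha> * (\<sigma> $ x) powr (- \<alpha>))) \<le> renyi_sum \<alpha> \<rho> \<sigma>"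
    if \<tau>: "\<tau> \<in> C" for \<tau>
  proof -
    \<comment> \<open>The Renyi sum along the segment from \<open>\<sigma>\<close> to
      \<open>\<tau>\<close>; its derivative \<open>l\<close> at 0 cannot be negative at a
      minimiser.\<close>
    define g where "g h = (\<Sum>x\<in>supp \<rho>. (\<rho> $ x) powr \<alpha> * (\<sigma> $ x + h * (\<tau> $ x - \<sigma> $ x)) powr (1 - \<alpha>))" for h
    define l where "l = (\<Sum>x\<in>supp \<rho>. (\<rho> $ x) powr \<alpha> * ((1 - \<alpha>) * (\<sigma> $ x) powr (- \<alpha>) * (\<tau> $ x - \<sigma> $ x)))"
    have "(g has_real_derivative l) (at 0)"
      unfolding g_def l_def
    proof (intro DERIV_sum DERIV_cmult)
      fix x assume x: "x \<in> supp \<rho>"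
      have "((\<lambda>h. \<sigma> $ x + h * (\<tau> $ x - \<sigma> $ x)) has_real_derivative (\<tau> $ x - \<sigma> $ x)) (at 0)"
        by (auto intro!: derivative_eq_intros)
      from DERIV_fun_powr[OF this, of "1 - \<alpha>"]
      show "((\<lambda>h. (\<sigma> $ x + h * (\<tau> $ x - \<sigma> $ x)) powr (1 - \<alpha>)) has_real_derivative
          (1 - \<alpha>) * (\<sigma> $ x) powr (- \<alpha>) * (\<tau> $ x - \<sigma> $ x)) (at 0)"
        using \<sigma>_pos[OF x] by simp
    qed
    have "0 \<le> l"
    proof (rule ccontr)
      assume "\<not> 0 \<le> l"
      then obtain d where d: "d > 0" "\<And>h. 0 < h \<Longrightarrow> h < d \<Longrightarrow> g h < g 0"
        using DERIV_neg_dec_right[OF \<open>(g has_real_derivative l) (at 0)\<close>] by auto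
      \<comment> \<open>Small enough for \<open>g\<close> to have dropped, and below 1 so that
        \<open>\<mu>\<close> keeps a positive share of \<open>\<sigma>\<close> and hence covers
        \<open>supp \<rho>\<close>.\<close>
      define h where "h = min (d / 2) (1 / 2)"
      have h: "0 < h" "h < d" "h < 1" using d by (auto simp: h_def)
      define \<mu> where "\<mu> = (1 - h) *\<^sub>R \<sigma> + h *\<^sub>R \<tau>"
      have "\<mu> \<in> C"
        using convexD[OF C(1) \<sigma>_C \<tau>, of "1 - h" h] h by (simp add: \<mu>_def)
      have \<mu>: "\<mu> $ x = \<sigma> $ x + h * (\<tau> $ x - \<sigma> $ x)" for x
        by (simp add: \<mu>_def algebra_simps)
      have "0 < \<mu> $ x" if "x \<in> supp \<rho>" for x
        using \<sigma>_pos[OF that] h densities_nonneg[of \<tau> x] \<tau> C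
        by (auto simp: \<mu>_def intro!: add_pos_nonneg)
      then have "supp \<rho> \<subseteq> supp \<mu>" by (force simp: supp_def)
      then have "renyi_sum \<alpha> \<rho> \<sigma> \<le> renyi_sum \<alpha> \<rho> \<mu>"
        using minimal \<open>\<mu> \<in> C\<close> by blast
      moreover have "renyi_sum \<alpha> \<rho> \<mu> = g h" "renyi_sum \<alpha> \<rho> \<sigma> = g 0"
        by (simp_all add: renyi_sum_def g_def \<mu>)
      ultimately show False using d(2)[OF h(1,2)] by simp
    qed
    \<comment> \<open>Since \<open>1 - \<alpha>\<close> is negative, \<open>0 \<le> l\<close> is the
      claimed upper bound.\<close>
    moreover have "l = (1 - \<alpha>) * ((\<Sum>x\<in>supp \<rho>. \<tau> $ x * ((\<rho> $ x) powr \<alpha> * (\<sigma> $ x) powr (- \<alpha>)))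
        - renyi_sum \<alpha> \<rho> \<sigma>)"
    proof -
      have "(\<sigma> $ x) powr (1 - \<alpha>) = \<sigma> $ x * (\<sigma> $ x) powr (- \<alpha>)" if "x \<in> supp \<rho>" for x
        using \<sigma>_pos[OF that] powr_add[of "\<sigma> $ x" 1 "- \<alpha>"] by simp
      then have "renyi_sum \<alpha> \<rho> \<sigma> = (\<Sum>x\<in>supp \<rho>. \<sigma> $ x * ((\<rho> $ x) powr \<alpha> * (\<sigma> $ x) powr (- \<alpha>)))"
        unfolding renyi_sum_def by (intro sum.cong) (auto simp: mult_ac)
      then show ?thesis
        by (simp add: l_def sum_distrib_left algebra_simps flip: sum_subtractf)
    qed
    ultimately show ?thesis using \<alpha> by (auto simp: zero_le_mult_iff)
  qed
  then show thesis using that[OF \<sigma>_C \<sigma>_supp] by blast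
qed

text \<open>Here \<open>s = (\<alpha> - 1) / \<alpha>\<close>. With
  \<open>w = (\<rho> / \<sigma>) powr \<alpha> / q\<close> on \<open>supp \<rho>\<close>, the sum of
  \<open>\<rho> * w powr s\<close> equals \<open>q powr (1 - s)\<close>, so \<open>w\<close> attains
  the value in \<open>bound\<close>. If no member of \<open>C\<close> covers
  \<open>supp \<rho>\<close>, an e-variable may be arbitrarily large at a point that all of
  \<open>C\<close> misses.\<close>

lemma optimal_e_variable:
  fixes C :: "(real ^ 'a::finite) set"
  assumes C: "convex C" "compact C" "C \<subseteq> densities" "C \<noteq> {}" and \<rho>: "\<rho> \<in> densities"
    and s: "0 < s" "s < 1"
    and bound: "\<And>\<sigma>. \<lbrakk>\<sigma> \<in> C; supp \<rho> \<subseteq> supp \<sigma>\<rbrakk> \<Longrightarrow> s * r - (1 - s) * ln (renyi_sum (1 / (1 - s)) \<rho> \<sigma>) < v"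
  shows "\<exists>f\<in>e_variables C. s * r - ln (moment \<rho> f s) < v"
proof (cases "\<exists>\<sigma>\<in>C. supp \<rho> \<subseteq> supp \<sigma>")
  case True
  define \<alpha> where "\<alpha> = 1 / (1 - s)"
  have \<alpha>: "1 < \<alpha>" "\<alpha> * s = \<alpha> - 1" using s by (auto simp: \<alpha>_def field_simps)
  obtain \<sigma> where \<sigma>: "\<sigma> \<in> C" "supp \<rho> \<subseteq> supp \<sigma>"
    "\<And>\<tau>. \<tau> \<in> C \<Longrightarrow> (\<Sum>x\<in>supp \<rho>. \<tau> $ x * ((\<rho> $ x) powr \<alpha> * (\<sigma> $ x) powr (- \<alpha>))) \<le> renyi_sum \<alpha> \<rho> \<sigma>"
    using renyi_sum_minimizer[OF C(1-3) \<rho> _ _ \<alpha>(1)] True by blast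
  define q where "q = renyi_sum \<alpha> \<rho> \<sigma>"
  have q: "0 < q" unfolding q_def using renyi_sum_pos \<rho> \<sigma> C by blast
  have "\<sigma> \<in> densities" using \<sigma>(1) C(3) by (rule subsetD[rotated])
  then have pos: "0 < \<rho> $ x" "0 < \<sigma> $ x" if "x \<in> supp \<rho>" for x
    using that subsetD[OF \<sigma>(2) that] by (simp_all add: densities_pos_iff \<rho>)
  define \<eta> where "\<eta> = v - (s * r - (1 - s) * ln q)"
  have \<eta>: "0 < \<eta>" using bound[OF \<sigma>(1,2)] by (simp add: \<eta>_def q_def \<alpha>_def)
  \<comment> \<open>Mixing \<open>w\<close> with the constant 1 makes it strictly positive and
    preserves the e-variable property. This weight costs \<open>s * \<eta> / 2\<close> in the log
    moment, less than the slack \<open>\<eta>\<close>.\<close>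
  define \<kappa> where "\<kappa> = exp (- \<eta> / 2)"
  have \<kappa>: "0 < \<kappa>" "\<kappa> < 1" using \<eta> by (auto simp: \<kappa>_def)
  define w where "w x = (if x \<in> supp \<rho> then (\<rho> $ x) powr \<alpha> * (\<sigma> $ x) powr (- \<alpha>) / q else 0)" for x
  have w_nonneg: "0 \<le> w x" for x using q by (simp add: w_def)
  define f where "f = (\<chi> x. \<kappa> * w x + (1 - \<kappa>))"
  have f_pos: "0 < f $ x" for x
    using \<kappa> w_nonneg[of x] by (auto simp: f_def intro!: add_nonneg_pos)
  have "(\<Sum>x\<in>UNIV. \<tau> $ x * f $ x) \<le> 1" if "\<tau> \<in> C" for \<tau>
  proof -
    have "(\<Sum>x\<in>UNIV. \<tau> $ x * w x) = (\<Sum>x\<in>supp \<rho>. \<tau> $ x * ((\<rho> $ x) powr \<alpha> * (\<sigma> $ x) powr (- \<alpha>))) / q"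
      unfolding sum_divide_distrib
      by (rule sum.mono_neutral_cong_right) (auto simp: w_def)
    also have "\<dots> \<le> 1" using \<sigma>(3)[OF that] q by (simp add: q_def)
    finally have "\<kappa> * (\<Sum>x\<in>UNIV. \<tau> $ x * w x) + (1 - \<kappa>) * (\<Sum>x\<in>UNIV. \<tau> $ x) \<le> \<kappa> * 1 + (1 - \<kappa>) * 1"
      using \<kappa> that C by (intro add_mono mult_left_mono) (auto simp: densities_sum subset_iff)
    then show ?thesis
      by (simp add: f_def sum_distrib_left algebra_simps flip: sum.distrib)
  qed
  then have "f \<in> e_variables C" using f_pos by (simp add: e_variables_def)
  moreover have "s * ln \<kappa> + (1 - s) * ln q \<le> ln (moment \<rho> f s)"
  proof -
    have "\<kappa> powr s * q powr (- s) * q = (\<Sum>x\<in>supp \<rho>. \<kappa> powr s * q powr (- s) * ((\<rho> $ x) powr \<alpha> * (\<sigma> $ x) powr (1 - \<alpha>)))"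
      by (simp add: q_def renyi_sum_def sum_distrib_left)
    also have "\<dots> \<le> (\<Sum>x\<in>supp \<rho>. \<rho> $ x * f $ x powr s)"
    proof (rule sum_mono)
      fix x assume x: "x \<in> supp \<rho>"
      have "(\<kappa> * w x) powr s \<le> f $ x powr s"
        using s \<kappa> w_nonneg[of x] by (intro powr_mono2) (auto simp: f_def)
      then have "\<rho> $ x * (\<kappa> * w x) powr s \<le> \<rho> $ x * f $ x powr s"
        using pos[OF x] by simp
      moreover have "(\<kappa> * w x) powr s = \<kappa> powr s * ((\<rho> $ x) powr (\<alpha> * s) * (\<sigma> $ x) powr (- (\<alpha> * s)) * q powr (- s))"
        using x \<kappa> q powr_minus_divide[of q s]
        by (simp add: w_def powr_mult powr_divide powr_powr)
      moreover have "(\<rho> $ x) powr \<alpha> = \<rho> $ x * (\<rho> $ x) powr (\<alpha> * s)"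
        using pos[OF x] powr_add[of "\<rho> $ x" 1 "\<alpha> * s"] by (simp add: \<alpha>)
      moreover have "1 - \<alpha> = - (\<alpha> * s)" using \<alpha> by simp
      ultimately show "\<kappa> powr s * q powr (- s) * ((\<rho> $ x) powr \<alpha> * (\<sigma> $ x) powr (1 - \<alpha>)) \<le> \<rho> $ x * f $ x powr s"
        by (simp add: mult_ac)
    qed
    also have "\<dots> = moment \<rho> f s"
      unfolding moment_def by (rule sum.mono_neutral_left) (auto simp: supp_def)
    finally have "ln (\<kappa> powr s * q powr (- s) * q) \<le> ln (moment \<rho> f s)"
      using \<kappa> q moment_pos[OF \<rho> f_pos, of s] by simp
    then show ?thesis using \<kappa> q by (simp add: ln_mult ln_powr algebra_simps)
  qed
  moreover have "- (s * ln \<kappa>) < \<eta>"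
  proof -
    have "s * \<eta> < 1 * \<eta>" using s \<eta> by (intro mult_strict_right_mono)
    then show ?thesis using \<eta> by (simp add: \<kappa>_def)
  qed
  ultimately show ?thesis unfolding \<eta>_def by force
next
  case False
  then obtain y where y: "y \<in> supp \<rho>" "\<And>\<sigma>. \<sigma> \<in> C \<Longrightarrow> \<sigma> $ y = 0"
    using common_support[OF C(1,3,4), of "supp \<rho>"] by auto
  have \<rho>y: "0 < \<rho> $ y" using y densities_pos_iff[OF \<rho>] by blast
  \<comment> \<open>Chosen so that \<open>ln (\<rho> $ y) + s * k = s * r - v + s\<close>: the term
    at \<open>y\<close> alone pushes the payoff down to \<open>v - s\<close>.\<close>
  define k where "k = (s * r - ln (\<rho> $ y) - v) / s + 1"
  define f :: "real ^ 'a" where "f = (\<chi> x. if x = y then exp k else 1)"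
  have "(\<Sum>x\<in>UNIV. \<sigma> $ x * f $ x) = (\<Sum>x\<in>UNIV. \<sigma> $ x)" if "\<sigma> \<in> C" for \<sigma>
    using y(2)[OF that] by (intro sum.cong) (auto simp: f_def)
  then have "f \<in> e_variables C"
    using C by (auto simp: e_variables_def f_def densities_sum subset_iff)
  moreover have "\<rho> $ y * exp (s * k) \<le> moment \<rho> f s"
  proof -
    have "\<rho> $ y * f $ y powr s \<le> moment \<rho> f s"
      unfolding moment_def by (rule member_le_sum) (auto simp: densities_nonneg[OF \<rho>])
    then show ?thesis by (simp add: f_def powr_def)
  qed
  then have "ln (\<rho> $ y * exp (s * k)) \<le> ln (moment \<rho> f s)"
    using \<rho>y by (intro ln_mono) auto
  then have "ln (\<rho> $ y) + s * k \<le> ln (moment \<rho> f s)"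
    using \<rho>y by (simp add: ln_mult)
  moreover have "s * k = s * r - ln (\<rho> $ y) - v + s"
    using s by (simp add: k_def field_simps)
  ultimately show ?thesis using s by force
qed

text \<open>Interior \<open>t\<close> are of the form \<open>(\<alpha> - 1) / \<alpha>\<close> with
  \<alpha> > 1. The endpoints are the limits \<alpha> = 1 and \<alpha> = \<infinity>: at 0 the
  moment is 1 and positivity of the bound suffices, while 1 is reached from a nearby interior point
  by convexity.\<close>

lemma pointwise_e_variable:
  fixes C :: "(real ^ 'a::finite) set"
  assumes C: "convex C" "compact C" "C \<subseteq> densities" "C \<noteq> {}" and \<rho>: "\<rho> \<in> densities"
    and v: "hoeffding_anti_set r {\<rho>} C < ereal v" and t: "0 \<le> t" "t \<le> 1"
  shows "\<exists>f\<in>e_variables C. t * r - ln (moment \<rho> f t) < v"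
proof -
  obtain \<sigma>1 where "\<sigma>1 \<in> C" using C by blast
  then have nonneg: "0 \<le> hoeffding_anti_set r {\<rho>} C"
    by (auto simp: hoeffding_anti_set_def hoeffding_anti_def intro!: SUP_upper2)
  then obtain v0 where v0: "hoeffding_anti_set r {\<rho>} C = ereal v0"
    using v by (cases "hoeffding_anti_set r {\<rho>} C") auto
  have v0_less: "0 \<le> v0" "v0 < v" using nonneg v by (simp_all add: v0)
  \<comment> \<open>Strictly above \<open>v0\<close> for the strict bound at interior points, and
    strictly below \<open>v\<close> for the passage to \<open>t = 1\<close>.\<close>
  define v' where "v' = (v0 + v) / 2"
  have v': "v0 < v'" "0 < v'" "v' < v" using v0_less by (auto simp: v'_def)
  have bound: "s * r - (1 - s) * ln (renyi_sum (1 / (1 - s)) \<rho> \<sigma>) \<le> v0"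
    if s: "0 < s" "s < 1" and \<sigma>: "\<sigma> \<in> C" "supp \<rho> \<subseteq> supp \<sigma>" for s \<sigma>
  proof -
    define \<alpha> where "\<alpha> = 1 / (1 - s)"
    have \<alpha>: "1 < \<alpha>" "(\<alpha> - 1) / \<alpha> = s" "s * (1 / (\<alpha> - 1)) = 1 - s" using s by (auto simp: \<alpha>_def field_simps)
    have "ereal ((\<alpha> - 1) / \<alpha>) * (ereal r - renyi_div \<alpha> \<rho> \<sigma>) \<le> hoeffding_anti r \<rho> \<sigma>"
      unfolding hoeffding_anti_def using \<alpha> by (auto intro!: max.coboundedI2 SUP_upper)
    also have "\<dots> \<le> hoeffding_anti_set r {\<rho>} C"
      unfolding hoeffding_anti_set_def using \<sigma> by (auto intro: SUP_upper)
    finally have "s * (r - 1 / (\<alpha> - 1) * ln (renyi_sum \<alpha> \<rho> \<sigma>)) \<le> v0"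
      by (simp add: renyi_div_eq[OF \<sigma>(2)] \<alpha>(2) v0)
    then have "s * r - (s * (1 / (\<alpha> - 1))) * ln (renyi_sum \<alpha> \<rho> \<sigma>) \<le> v0"
      by (simp add: algebra_simps)
    then show ?thesis unfolding \<alpha>(3) by (simp add: \<alpha>_def)
  qed
  have interior: "\<exists>f\<in>e_variables C. s * r - ln (moment \<rho> f s) < v'" if "0 < s" "s < 1" for s
    using bound[OF that] v' that by (intro optimal_e_variable C \<rho>) (auto intro: le_less_trans)
  consider "t = 0" | "0 < t" "t < 1" | "t = 1" using t by linarith
  then show ?thesis
  proof cases
    case 1
    then show ?thesis
      using v' const_1_e_variable[OF C(3)] by (auto simp: moment_0[OF \<rho>] intro!: bexI[of _ "\<chi> x. 1"])
  next
    case 2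
    then show ?thesis using interior v' by (meson less_trans)
  next
    case 3
    \<comment> \<open>Then \<open>v' = s * v\<close>. As the log moment vanishes at 0, convexity
      bounds its value at \<open>s\<close> by \<open>s\<close> times its value at 1, so dividing the
      estimate at \<open>s\<close> by \<open>s\<close> gives the one at 1.\<close>
    define s where "s = v' / v"
    have s: "0 < s" "s < 1" using v' by (auto simp: s_def)
    obtain f where f: "f \<in> e_variables C" "s * r - ln (moment \<rho> f s) < v'"
      using interior[OF s] by blast
    then have f_pos: "\<And>x. 0 < f $ x" by (simp add: e_variables_def)
    define m where "m = tilted_log \<rho> f s"
    \<comment> \<open>The tangent at \<open>s\<close> evaluated at 0 and 1; with weights
      \<open>1 - s\<close> and \<open>s\<close> the slope \<open>m\<close> cancels.\<close>
    have "ln (moment \<rho> f s) - s * m \<le> 0" "ln (moment \<rho> f s) + (1 - s) * m \<le> ln (moment \<rho> f 1)"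
      using ln_moment_tangent[OF \<rho> f_pos, of s 0] ln_moment_tangent[OF \<rho> f_pos, of s 1]
      by (simp_all add: m_def moment_0[OF \<rho> f_pos])
    then have "(1 - s) * (ln (moment \<rho> f s) - s * m) + s * (ln (moment \<rho> f s) + (1 - s) * m) \<le> (1 - s) * 0 + s * ln (moment \<rho> f 1)"
      using s by (intro add_mono mult_left_mono) auto
    then have "ln (moment \<rho> f s) \<le> s * ln (moment \<rho> f 1)"
      by (simp add: algebra_simps)
    then have "s * (r - ln (moment \<rho> f 1)) < s * v"
      using f s v' by (simp add: s_def algebra_simps)
    then have "1 * r - ln (moment \<rho> f 1) < v" using s by simp
    then show ?thesis using f 3 by blast
  qed
qed

section \<open>Strong converse exponents of composite alternatives\<close>

lemma rate_ge:
  assumes "0 \<le> p" "p \<le> exp (- (n * r))" "0 < n"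
  shows "ereal r \<le> rate n p"
proof (cases "p = 0")
  case False
  then have "ln p \<le> ln (exp (- (n * r)))" using assms by (subst ln_le_cancel_iff) auto
  then have "n * r \<le> - ln p" by simp
  then have "r \<le> 1 / n * - ln p" using assms by (simp add: field_simps)
  then show ?thesis using False by (simp add: rate_def neg_log_def)
qed (use assms in \<open>simp add: rate_def neg_log_def\<close>)

lemma rate_antimono: "0 \<le> p \<Longrightarrow> p \<le> q \<Longrightarrow> rate n q \<le> rate n p"
proof (cases "p = 0")
  assume "p \<noteq> 0" "0 \<le> p" "p \<le> q"
  then have "1 / real n * - ln q \<le> 1 / real n * - ln p" by (intro mult_left_mono) auto
  then show ?thesis using \<open>p \<noteq> 0\<close> \<open>0 \<le> p\<close> \<open>p \<le> q\<close> by (simp add: rate_def neg_log_def)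
next
  assume "p = 0"
  \<comment> \<open>At \<open>n = 0\<close> the factor \<open>1 / real n\<close> is 0 and
    \<open>0 * \<infinity> = 0\<close> in \<open>ereal\<close>, so both rates are 0.\<close>
  then show ?thesis by (cases "n = 0") (auto simp: rate_def neg_log_def)
qed

lemma rate_nonneg: "0 \<le> p \<Longrightarrow> p \<le> 1 \<Longrightarrow> 0 \<le> rate n p"
  using rate_antimono[of p 1 n] by (simp add: rate_def neg_log_def)

text \<open>Under an adversary, the partial products of an e-variable form a supermartingale.\<close>

lemma adversarial_prod_le_1:
  fixes C :: "(real ^ 'a::finite) set"
  assumes \<omega>: "\<omega> \<in> adversarial C n" and f: "f \<in> e_variables C"
  shows "(\<Sum>xs\<in>words n. \<omega> xs * (\<Prod>k<n. f $ (xs ! k))) \<le> 1"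
proof -
  have wd: "\<And>xs. 0 \<le> \<omega> xs" "(\<Sum>xs\<in>words n. \<omega> xs) = 1"
    and first: "(\<chi> x. prefix_marginal n \<omega> [x]) \<in> C"
    and later: "\<And>k xs. \<lbrakk>1 \<le> k; k < n; xs \<in> words k; 0 < prefix_marginal n \<omega> xs\<rbrakk> \<Longrightarrow> conditional n \<omega> xs \<in> C"
    using \<omega> by (auto simp: adversarial_def word_densities_def)
  have f_pos: "\<And>x. 0 < f $ x" and f_le: "\<And>\<sigma>. \<sigma> \<in> C \<Longrightarrow> (\<Sum>x\<in>UNIV. \<sigma> $ x * f $ x) \<le> 1"
    using f by (auto simp: e_variables_def)
  let ?m = "prefix_marginal n \<omega>"
  have m_nonneg: "0 \<le> ?m xs" for xs by (simp add: prefix_marginal_def sum_nonneg wd)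
  have m_Nil: "?m [] = 1" by (simp add: prefix_marginal_def wd)
  have split: "?m xs = (\<Sum>x\<in>UNIV. ?m (xs @ [x]))" if "xs \<in> words k" "k < n" for xs k
  proof -
    have j: "n - length xs = Suc (n - Suc (length xs))"
      using that by (simp add: words_def)
    show ?thesis
      unfolding prefix_marginal_def j sum_words_Suc by simp
  qed
  have step: "(\<Sum>x\<in>UNIV. ?m (xs @ [x]) * f $ x) \<le> ?m xs" if "xs \<in> words k" "k < n" for xs k
  proof (cases "0 < ?m xs")
    case True
    have "conditional n \<omega> xs \<in> C"
    \<comment> \<open>The definition of \<open>adversarial\<close> constrains the first letter by
      its marginal, which is the conditional given the empty prefix because that prefix has marginal
      1.\<close>
    proof (cases "k = 0")
      case True
      then have "xs = []" using that by (simp add: words_def)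
      then show ?thesis using first by (simp add: conditional_def m_Nil)
    qed (use later[of k xs] that True in auto)
    from f_le[OF this] have "(\<Sum>x\<in>UNIV. ?m (xs @ [x]) * f $ x) / ?m xs \<le> 1"
      by (simp add: conditional_def sum_divide_distrib)
    then show ?thesis using True by simp
  next
    \<comment> \<open>A null prefix has an unconstrained conditional, but all its extensions are
      null as well.\<close>
    case False
    then have "?m xs = 0" using m_nonneg[of xs] by simp
    then have "\<And>x. ?m (xs @ [x]) = 0"
      using split[OF that] m_nonneg by (simp add: sum_nonneg_eq_0_iff)
    then show ?thesis using m_nonneg[of xs] by simp
  qed
  have "(\<Sum>xs\<in>words k. ?m xs * (\<Prod>i<k. f $ (xs ! i))) \<le> 1" if "k \<le> n" for k
    using that
  proof (induction k)
    case 0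
    then show ?case by (simp add: words_0 m_Nil)
  next
    case (Suc k)
    have "(\<Sum>xs\<in>words (Suc k). ?m xs * (\<Prod>i<Suc k. f $ (xs ! i)))
        = (\<Sum>xs\<in>words k. (\<Prod>i<k. f $ (xs ! i)) * (\<Sum>x\<in>UNIV. ?m (xs @ [x]) * f $ x))"
    proof (unfold sum_words_snoc, rule sum.cong[OF refl])
      fix xs :: "'a list" assume "xs \<in> words k"
      then have len: "length xs = k" by (simp add: words_def)
      then have "(\<Prod>i<k. f $ ((xs @ [x]) ! i)) = (\<Prod>i<k. f $ (xs ! i))" for x
        by (intro prod.cong) (auto simp: nth_append)
      then show "(\<Sum>x\<in>UNIV. ?m (xs @ [x]) * (\<Prod>i<Suc k. f $ ((xs @ [x]) ! i)))
          = (\<Prod>i<k. f $ (xs ! i)) * (\<Sum>x\<in>UNIV. ?m (xs @ [x]) * f $ x)"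
        by (simp add: len nth_append sum_distrib_left mult_ac)
    qed
    also have "\<dots> \<le> (\<Sum>xs\<in>words k. (\<Prod>i<k. f $ (xs ! i)) * ?m xs)"
      using Suc.prems f_pos by (intro sum_mono mult_left_mono step) (auto intro!: prod_nonneg simp: less_imp_le)
    also have "\<dots> \<le> 1" using Suc by (simp add: mult_ac)
    finally show ?case .
  qed
  from this[of n] have "(\<Sum>xs\<in>words n. ?m xs * (\<Prod>i<n. f $ (xs ! i))) \<le> 1" by simp
  moreover have "?m xs = \<omega> xs" if "xs \<in> words n" for xs
    using that by (simp add: prefix_marginal_def words_0 words_def)
  ultimately show ?thesis by simp
qed

section \<open>Comparison of the alternative hypotheses and their exponents\<close>

lemma prod_lessThan_add:
  fixes g :: "nat \<Rightarrow> 'b::comm_monoid_mult"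
  shows "(\<Prod>k<l + m. g k) = (\<Prod>k<l. g k) * (\<Prod>k<m. g (l + k))"
  by (induction m) (simp_all add: mult_ac)

lemma prefix_marginal_tensor:
  fixes s :: "nat \<Rightarrow> real ^ 'a::finite"
  assumes s: "\<And>k. k < n \<Longrightarrow> s k \<in> densities" and xs: "length xs \<le> n"
  shows "prefix_marginal n (tensor n s) xs = (\<Prod>k<length xs. s k $ (xs ! k))"
proof -
  define l where "l = length xs"
  have "tensor n s (xs @ ys) = (\<Prod>k<l. s k $ (xs ! k)) * (\<Prod>k<n - l. s (l + k) $ (ys ! k))"
    if "ys \<in> words (n - l)" for ys
  proof -
    have "xs @ ys \<in> words n" using that xs by (simp add: words_def l_def)
    then have "tensor n s (xs @ ys) = (\<Prod>k<l + (n - l). s k $ ((xs @ ys) ! k))"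
      using xs by (simp add: tensor_def l_def)
    also have "\<dots> = (\<Prod>k<l. s k $ ((xs @ ys) ! k)) * (\<Prod>k<n - l. s (l + k) $ ((xs @ ys) ! (l + k)))"
      by (rule prod_lessThan_add)
    also have "(\<Prod>k<l. s k $ ((xs @ ys) ! k)) = (\<Prod>k<l. s k $ (xs ! k))"
      by (intro prod.cong) (auto simp: nth_append l_def)
    finally show ?thesis by (simp add: nth_append l_def)
  qed
  then have "prefix_marginal n (tensor n s) xs
      = (\<Prod>k<l. s k $ (xs ! k)) * (\<Sum>ys\<in>words (n - l). \<Prod>k<n - l. s (l + k) $ (ys ! k))"
    by (simp add: prefix_marginal_def sum_distrib_left flip: l_def)
  also have "(\<Sum>ys\<in>words (n - l). \<Prod>k<n - l. s (l + k) $ (ys ! k)) = 1"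
    using s sum_words_prod[of "\<lambda>k x. s (l + k) $ x" "n - l"] by (simp add: densities_sum)
  finally show ?thesis by (simp add: l_def)
qed

text \<open>Under a product the conditional after any prefix of positive probability is the next
  factor. Length 0 is excluded because there the vector of first marginals is zero, which is not a
  density.\<close>

lemma arb_varying_subset_adversarial:
  fixes A :: "(real ^ 'a::finite) set"
  assumes A: "A \<subseteq> densities" and n: "0 < n"
  shows "arb_varying A n \<subseteq> adversarial A n"
proof
  fix \<omega> assume "\<omega> \<in> arb_varying A n"
  then obtain s where \<omega>: "\<omega> = tensor n s" and s: "\<And>k. k < n \<Longrightarrow> s k \<in> A"
    by (auto simp: arb_varying_def)
  have s_dens: "\<And>k. k < n \<Longrightarrow> s k \<in> densities" using s A by blast
  have "(\<chi> x. prefix_marginal n \<omega> [x]) = s 0"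
    using n by (simp add: \<omega> prefix_marginal_tensor s_dens vec_eq_iff)
  moreover have "conditional n \<omega> xs = s k"
    if "k < n" "xs \<in> words k" "0 < prefix_marginal n \<omega> xs" for k xs
  proof -
    have len: "length xs = k" using that by (simp add: words_def)
    have "prefix_marginal n \<omega> (xs @ [x]) = prefix_marginal n \<omega> xs * s k $ x" for x
      using that(1) by (simp add: \<omega> prefix_marginal_tensor s_dens len nth_append)
    then show ?thesis using that(3) by (simp add: conditional_def vec_eq_iff)
  qed
  ultimately show "\<omega> \<in> adversarial A n"
    using s n tensor_word_density[of n s, OF s_dens]
    by (auto simp: adversarial_def simp flip: \<omega>)
qed

lemma iid_subset_arb_varying: "iid A n \<subseteq> arb_varying A n"
  by (auto simp: iid_def arb_varying_def tensor_power_def)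

lemma arb_varying_word_densities: "A \<subseteq> densities \<Longrightarrow> arb_varying A n \<subseteq> word_densities n"
  by (auto simp: arb_varying_def intro!: tensor_word_density)

lemma adversarial_mono: "A \<subseteq> B \<Longrightarrow> adversarial A n \<subseteq> adversarial B n"
  by (auto simp: adversarial_def)

lemma iid_nonempty: "A \<noteq> {} \<Longrightarrow> iid A n \<noteq> {}"
  by (simp add: iid_def)

lemma arb_varying_nonempty: "A \<noteq> {} \<Longrightarrow> arb_varying A n \<noteq> {}"
  using iid_subset_arb_varying iid_nonempty by blast

lemma test_seqs_bounds: "T \<in> test_seqs \<Longrightarrow> xs \<in> words n \<Longrightarrow> 0 \<le> T n xs \<and> T n xs \<le> 1"
  by (auto simp: test_seqs_def)

lemma bdd_above_test_prob:
  assumes "T \<in> test_seqs" "A \<subseteq> word_densities n"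
  shows "bdd_above ((\<lambda>\<omega>. test_prob n \<omega> (T n)) ` A)"
  using assms by (intro bdd_aboveI2[of _ _ 1] test_prob_bounds) (auto dest: test_seqs_bounds)

lemma SUP_test_prob_nonneg:
  assumes T: "T \<in> test_seqs" and A: "A \<subseteq> word_densities n" "A \<noteq> {}"
  shows "0 \<le> (SUP \<omega>\<in>A. test_prob n \<omega> (T n))"
proof -
  obtain \<omega> where \<omega>: "\<omega> \<in> A" using A by blast
  have "0 \<le> test_prob n \<omega> (T n)"
    using \<omega> A T by (intro test_prob_bounds) (auto dest: test_seqs_bounds)
  also have "\<dots> \<le> (SUP \<omega>\<in>A. test_prob n \<omega> (T n))"
    using \<omega> bdd_above_test_prob[OF T A(1)] by (intro cSUP_upper)
  finally show ?thesis .
qed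

text \<open>Only lengths \<open>n > 0\<close> matter; in particular \<open>adversarial A 0\<close> may be empty.\<close>

lemma sc0_mono:
  assumes "\<And>n. 0 < n \<Longrightarrow> A n \<subseteq> B n" and "\<And>n. 0 < n \<Longrightarrow> A n \<noteq> {}"
    and "\<And>n. 0 < n \<Longrightarrow> B n \<subseteq> word_densities n"
  shows "sc0 r R A \<le> sc0 r R B"
  unfolding sc0_def
proof (rule INF_superset_mono[OF _ order_refl], rule subsetI)
  fix T assume "T \<in> {T \<in> test_seqs. ereal r \<le> liminf (\<lambda>n. rate n (SUP \<omega>\<in>B n. test_prob n \<omega> (T n)))}"
  then have T: "T \<in> test_seqs" and B: "ereal r \<le> liminf (\<lambda>n. rate n (SUP \<omega>\<in>B n. test_prob n \<omega> (T n)))"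
    by auto
  note B
  also have "liminf (\<lambda>n. rate n (SUP \<omega>\<in>B n. test_prob n \<omega> (T n)))
      \<le> liminf (\<lambda>n. rate n (SUP \<omega>\<in>A n. test_prob n \<omega> (T n)))"
  proof (rule Liminf_mono)
    show "\<forall>\<^sub>F n in sequentially. rate n (SUP \<omega>\<in>B n. test_prob n \<omega> (T n))
        \<le> rate n (SUP \<omega>\<in>A n. test_prob n \<omega> (T n))"
      using eventually_gt_at_top[of 0]
    proof eventually_elim
      case (elim n)
      have "(SUP \<omega>\<in>A n. test_prob n \<omega> (T n)) \<le> (SUP \<omega>\<in>B n. test_prob n \<omega> (T n))"
        using assms[OF elim] by (intro cSUP_subset_mono bdd_above_test_prob T) auto
      moreover have "0 \<le> (SUP \<omega>\<in>A n. test_prob n \<omega> (T n))"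
        using assms[OF elim] by (intro SUP_test_prob_nonneg T) auto
      ultimately show ?case by (rule rate_antimono[rotated])
    qed
  qed
  finally show "T \<in> {T \<in> test_seqs. ereal r \<le> liminf (\<lambda>n. rate n (SUP \<omega>\<in>A n. test_prob n \<omega> (T n)))}"
    using T by simp
qed

text \<open>A uniform error bound over \<open>A\<close> implies the pointwise ones, so the infimum
  on the left runs over more tests.\<close>

lemma sc01_le_sc0_iid:
  assumes A: "A \<subseteq> densities"
  shows "sc01 r R A \<le> sc0 r R (iid A)"
  unfolding sc0_def sc01_def
proof (rule INF_superset_mono[OF _ order_refl], rule subsetI)
  fix T assume "T \<in> {T \<in> test_seqs. ereal r \<le> liminf (\<lambda>n. rate n (SUP \<omega>\<in>iid A n. test_prob n \<omega> (T n)))}"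
  then have T: "T \<in> test_seqs" and B: "ereal r \<le> liminf (\<lambda>n. rate n (SUP \<omega>\<in>iid A n. test_prob n \<omega> (T n)))"
    by auto
  have "ereal r \<le> liminf (\<lambda>n. rate n (test_prob n (tensor_power n \<sigma>) (T n)))" if \<sigma>: "\<sigma> \<in> A" for \<sigma>
  proof -
    note B
    also have "liminf (\<lambda>n. rate n (SUP \<omega>\<in>iid A n. test_prob n \<omega> (T n)))
        \<le> liminf (\<lambda>n. rate n (test_prob n (tensor_power n \<sigma>) (T n)))"
    proof (rule Liminf_mono, rule always_eventually, rule allI, rule rate_antimono)
      fix n
      have "iid A n \<subseteq> word_densities n" using A by (auto simp: iid_def intro!: tensor_power_word_density)
      then show "test_prob n (tensor_power n \<sigma>) (T n) \<le> (SUP \<omega>\<in>iid A n. test_prob n \<omega> (T n))"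
        using \<sigma> by (intro cSUP_upper bdd_above_test_prob T) (auto simp: iid_def)
      show "0 \<le> test_prob n (tensor_power n \<sigma>) (T n)"
        using \<sigma> A T by (intro test_prob_bounds tensor_power_word_density) (auto dest: test_seqs_bounds)
    qed
    finally show ?thesis .
  qed
  then show "T \<in> {T \<in> test_seqs. \<forall>\<sigma>\<in>A. ereal r \<le> liminf (\<lambda>n. rate n (test_prob n (tensor_power n \<sigma>) (T n)))}"
    using T by simp
qed

text \<open>A test feasible for all of \<open>A\<close> is feasible for \<open>\<sigma>\<close>
  alone, and dropping the other members of \<open>R\<close> can only lower its success
  exponent.\<close>

lemma sc_le_sc01:
  assumes "\<rho> \<in> R" "\<sigma> \<in> A"
  shows "sc r \<rho> \<sigma> \<le> sc01 r R A"
  unfolding sc01_def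
proof (rule INF_greatest, clarify)
  fix T :: "nat \<Rightarrow> 'a list \<Rightarrow> real"
  assume T: "T \<in> test_seqs" "\<forall>\<sigma>\<in>A. ereal r \<le> liminf (\<lambda>n. rate n (test_prob n (tensor_power n \<sigma>) (T n)))"
  then have "sc r \<rho> \<sigma> \<le> success_exponent {\<rho>} T"
    unfolding sc_def sc0_def using assms by (intro INF_lower) (simp add: iid_def)
  also have "\<dots> \<le> success_exponent R T"
    unfolding success_exponent_def using assms by (intro SUP_subset_mono) auto
  finally show "sc r \<rho> \<sigma> \<le> success_exponent R T" .
qed

text \<open>The acceptance probability is affine in each factor of the alternative, so the
  factors can be moved from \<open>A\<close> to its closed convex hull one at a time.\<close>

lemma arb_varying_hull_bound:
  fixes A :: "(real ^ 'a::finite) set"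
  assumes M: "\<And>\<omega>. \<omega> \<in> arb_varying A n \<Longrightarrow> test_prob n \<omega> t \<le> M"
    and \<omega>: "\<omega> \<in> arb_varying (closure (convex hull A)) n"
  shows "test_prob n \<omega> t \<le> M"
proof -
  let ?C = "closure (convex hull A)"
  \<comment> \<open>Hybrid argument: the first \<open>m\<close> factors range over the hull and the
    others over \<open>A\<close>.\<close>
  have "\<forall>s. (\<forall>k<n. s k \<in> (if k < m then ?C else A)) \<longrightarrow> test_prob n (tensor n s) t \<le> M" if "m \<le> n" for m
    using that
  proof (induction m)
    case 0
    then show ?case using M by (auto simp: arb_varying_def)
  next
    case (Suc m)
    show ?case
    proof (intro allI impI)
      fix s :: "nat \<Rightarrow> real ^ 'a" assume s: "\<forall>k<n. s k \<in> (if k < Suc m then ?C else A)"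
      define c where "c xs = (\<Prod>k\<in>{..<n} - {m}. s k $ (xs ! k)) * t xs" for xs
      \<comment> \<open>The admissible choices for factor \<open>m\<close> with the others fixed.
        The set is closed and convex, and contains \<open>A\<close> by the induction hypothesis,
        hence contains the hull.\<close>
      define K where "K = {v::real ^ 'a. (\<Sum>xs\<in>words n. v $ (xs ! m) * c xs) \<le> M}"
      have affine: "test_prob n (tensor n (s(m := v))) t = (\<Sum>xs\<in>words n. v $ (xs ! m) * c xs)" for v
        unfolding test_prob_def
      proof (rule sum.cong[OF refl])
        fix xs :: "'a list" assume xs: "xs \<in> words n"
        have "(\<Prod>k<n. (s(m := v)) k $ (xs ! k)) = v $ (xs ! m) * (\<Prod>k\<in>{..<n} - {m}. s k $ (xs ! k))"
          using Suc.prems by (subst prod.remove[of _ m]) auto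
        then show "tensor n (s(m := v)) xs * t xs = v $ (xs ! m) * c xs"
          using xs by (simp add: tensor_def c_def)
      qed
      have "A \<subseteq> K"
      proof
        fix v assume "v \<in> A"
        then have "\<forall>k<n. (s(m := v)) k \<in> (if k < m then ?C else A)"
          using s by (auto simp: less_Suc_eq)
        then have "test_prob n (tensor n (s(m := v))) t \<le> M"
          using Suc by (metis Suc_leD)
        then show "v \<in> K" by (simp add: K_def affine)
      qed
      moreover have "convex K"
      proof (rule convexI)
        fix v w :: "real ^ 'a" and a b :: real
        assume vw: "v \<in> K" "w \<in> K" and ab: "0 \<le> a" "0 \<le> b" "a + b = 1"
        have "(\<Sum>xs\<in>words n. (a *\<^sub>R v + b *\<^sub>R w) $ (xs ! m) * c xs)
            = a * (\<Sum>xs\<in>words n. v $ (xs ! m) * c xs) + b * (\<Sum>xs\<in>words n. w $ (xs ! m) * c xs)"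
          by (simp add: sum_distrib_left algebra_simps flip: sum.distrib)
        also have "\<dots> \<le> a * M + b * M"
          using vw ab by (intro add_mono mult_left_mono) (auto simp: K_def)
        also have "\<dots> = M" using ab by (simp flip: distrib_right)
        finally show "a *\<^sub>R v + b *\<^sub>R w \<in> K" by (simp add: K_def)
      qed
      moreover have "closed K"
        unfolding K_def by (intro closed_Collect_le continuous_intros)
      ultimately have "?C \<subseteq> K"
        by (intro closure_minimal hull_minimal)
      moreover have "s m \<in> ?C" using s[rule_format, of m] Suc.prems by simp
      ultimately have "test_prob n (tensor n (s(m := s m))) t \<le> M"
        unfolding affine by (auto simp: K_def)
      then show "test_prob n (tensor n s) t \<le> M" by simp
    qed
  qed
  from this[of n] \<omega> show ?thesis by (auto simp: arb_varying_def)
qed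

lemma sc0_arb_varying_hull:
  assumes A: "A \<noteq> {}" "closure (convex hull A) \<subseteq> densities"
  shows "sc0 r R (arb_varying A) = sc0 r R (arb_varying (closure (convex hull A)))"
proof -
  let ?C = "closure (convex hull A)"
  have sub: "A \<subseteq> ?C" by (rule subset_trans[OF hull_subset closure_subset])
  have "(SUP \<omega>\<in>arb_varying A n. test_prob n \<omega> (T n)) = (SUP \<omega>\<in>arb_varying ?C n. test_prob n \<omega> (T n))"
    if T: "T \<in> test_seqs" for T and n :: nat
  proof (rule antisym)
    have "arb_varying A n \<subseteq> arb_varying ?C n"
      using sub by (auto simp: arb_varying_def)
    then show "(SUP \<omega>\<in>arb_varying A n. test_prob n \<omega> (T n)) \<le> (SUP \<omega>\<in>arb_varying ?C n. test_prob n \<omega> (T n))"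
      using A by (intro cSUP_subset_mono bdd_above_test_prob T arb_varying_word_densities arb_varying_nonempty) auto
    show "(SUP \<omega>\<in>arb_varying ?C n. test_prob n \<omega> (T n)) \<le> (SUP \<omega>\<in>arb_varying A n. test_prob n \<omega> (T n))"
    proof (rule cSUP_least)
      fix \<omega> assume "\<omega> \<in> arb_varying ?C n"
      moreover have "A \<subseteq> densities" using sub A(2) by (rule subset_trans)
      ultimately show "test_prob n \<omega> (T n) \<le> (SUP \<omega>\<in>arb_varying A n. test_prob n \<omega> (T n))"
        by (intro arb_varying_hull_bound[of A n "T n" _ \<omega>])
          (rule cSUP_upper, assumption, rule bdd_above_test_prob[OF T arb_varying_word_densities])
    qed (use A arb_varying_nonempty[of ?C n] in auto)
  qed
  then show ?thesis by (auto simp: sc0_def intro!: INF_cong)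
qed

section \<open>The converse for a pair of densities\<close>

text \<open>Where \<open>a\<close> exceeds \<open>K b\<close>, the ratio \<open>a / (K b)\<close> is
  at least 1, and multiplying \<open>a\<close> by its power \<alpha> - 1 produces the second term.
  Since \<open>0 powr (1 - \<alpha>)\<close> is 0, the bound would fail for
  \<open>b = 0 < a\<close>, which the last hypothesis excludes.\<close>

lemma change_of_measure_bound:
  fixes a b K \<alpha> :: real
  assumes "0 < K" "1 < \<alpha>" "0 \<le> a" "0 \<le> b" "b = 0 \<Longrightarrow> a = 0"
  shows "a \<le> K * b + K powr (1 - \<alpha>) * (a powr \<alpha> * b powr (1 - \<alpha>))"
proof (cases "a \<le> K * b")
  case True
  then show ?thesis by (rule add_increasing2[rotated]) simp
next
  case False
  then have "b \<noteq> 0" using assms by auto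
  then have "0 < b" "0 < K * b" using assms by auto
  then have b: "0 < b" "0 < a" "1 \<le> a / (K * b)" using False by (simp_all add: pos_le_divide_eq)
  have "a * 1 \<le> a * (a / (K * b)) powr (\<alpha> - 1)"
    using b assms by (intro mult_left_mono ge_one_powr_ge_zero) auto
  also have "\<dots> = K powr (1 - \<alpha>) * (a powr \<alpha> * b powr (1 - \<alpha>))"
  proof -
    have "a * a powr (\<alpha> - 1) = a powr \<alpha>" using b powr_add[of a 1 "\<alpha> - 1"] by simp
    moreover have "1 / K powr (\<alpha> - 1) = K powr (1 - \<alpha>)" "1 / b powr (\<alpha> - 1) = b powr (1 - \<alpha>)"
      using powr_minus_divide[of K "\<alpha> - 1"] powr_minus_divide[of b "\<alpha> - 1"] by simp_all
    moreover have "a * (a / (K * b)) powr (\<alpha> - 1) = (a * a powr (\<alpha> - 1)) * (1 / K powr (\<alpha> - 1)) * (1 / b powr (\<alpha> - 1))"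
      using assms b by (simp add: powr_divide powr_mult)
    ultimately show ?thesis by (simp add: mult_ac)
  qed
  also have "\<dots> \<le> K * b + \<dots>" using assms by simp
  finally show ?thesis by simp
qed

text \<open>Additivity of the Renyi divergence on tensor powers, in exponentiated form.\<close>

lemma sum_words_renyi:
  assumes \<rho>: "\<rho> \<in> densities" and \<sigma>: "\<sigma> \<in> densities"
  shows "(\<Sum>xs\<in>words n. tensor_power n \<rho> xs powr \<alpha> * tensor_power n \<sigma> xs powr (1 - \<alpha>))
    = renyi_sum \<alpha> \<rho> \<sigma> ^ n"
proof -
  have "(\<Sum>xs\<in>words n. tensor_power n \<rho> xs powr \<alpha> * tensor_power n \<sigma> xs powr (1 - \<alpha>))
      = (\<Sum>xs\<in>words n. \<Prod>k<n. (\<rho> $ (xs ! k)) powr \<alpha> * (\<sigma> $ (xs ! k)) powr (1 - \<alpha>))"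
    by (rule sum.cong[OF refl])
      (simp add: tensor_power_word prod_powr_distrib densities_nonneg \<rho> \<sigma> prod.distrib)
  also have "\<dots> = (\<Sum>x\<in>UNIV. (\<rho> $ x) powr \<alpha> * (\<sigma> $ x) powr (1 - \<alpha>)) ^ n"
    using sum_words_prod[of "\<lambda>k x. (\<rho> $ x) powr \<alpha> * (\<sigma> $ x) powr (1 - \<alpha>)" n] by simp
  also have "(\<Sum>x\<in>UNIV. (\<rho> $ x) powr \<alpha> * (\<sigma> $ x) powr (1 - \<alpha>)) = renyi_sum \<alpha> \<rho> \<sigma>"
    unfolding renyi_sum_def by (rule sum.mono_neutral_right) (auto simp: supp_def)
  finally show ?thesis .
qed

lemma test_prob_converse:
  assumes \<rho>: "\<rho> \<in> densities" and \<sigma>: "\<sigma> \<in> densities" and supp: "supp \<rho> \<subseteq> supp \<sigma>"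
    and K: "0 < K" and \<alpha>: "1 < \<alpha>"
    and t: "\<And>xs. xs \<in> words n \<Longrightarrow> 0 \<le> t xs \<and> t xs \<le> 1"
  shows "test_prob n (tensor_power n \<rho>) t
    \<le> K * test_prob n (tensor_power n \<sigma>) t + K powr (1 - \<alpha>) * renyi_sum \<alpha> \<rho> \<sigma> ^ n"
proof -
  let ?a = "tensor_power n \<rho>" and ?b = "tensor_power n \<sigma>"
  have nonneg: "0 \<le> ?a xs" "0 \<le> ?b xs" for xs
    using tensor_power_word_density[OF \<rho>, of n] tensor_power_word_density[OF \<sigma>, of n]
    by (auto simp: word_densities_def)
  have "test_prob n ?a t
      \<le> (\<Sum>xs\<in>words n. K * (?b xs * t xs) + K powr (1 - \<alpha>) * (?a xs powr \<alpha> * ?b xs powr (1 - \<alpha>)))"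
    unfolding test_prob_def
  proof (rule sum_mono)
    fix xs :: "'a list" assume xs: "xs \<in> words n"
    let ?c = "K powr (1 - \<alpha>) * (?a xs powr \<alpha> * ?b xs powr (1 - \<alpha>))"
    have "?a xs = 0" if "?b xs = 0"
      using that supp xs by (auto simp: tensor_power_word supp_def)
    then have "?a xs \<le> K * ?b xs + ?c"
      using K \<alpha> nonneg by (intro change_of_measure_bound)
    then have "?a xs * t xs \<le> (K * ?b xs + ?c) * t xs"
      using t[OF xs] by (intro mult_right_mono) auto
    also have "\<dots> \<le> K * (?b xs * t xs) + ?c"
    proof -
      have "?c * t xs \<le> ?c" using t[OF xs] by (intro mult_left_le) auto
      then show ?thesis by (simp add: distrib_right mult.assoc)
    qed
    finally show "?a xs * t xs \<le> K * (?b xs * t xs) + ?c" .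
  qed
  then show ?thesis
    by (simp add: sum.distrib test_prob_def sum_words_renyi[OF \<rho> \<sigma>] flip: sum_distrib_left)
qed

text \<open>For each \<alpha> the likelihood threshold \<open>K = exp (n k)\<close> is chosen to
  make both terms of \<open>test_prob_converse\<close> decay at the same rate. The
  \<open>max 0\<close> is covered because success probabilities are at most 1.\<close>

lemma hoeffding_anti_le_sc:
  assumes \<rho>: "\<rho> \<in> densities" and \<sigma>: "\<sigma> \<in> densities"
  shows "hoeffding_anti r \<rho> \<sigma> \<le> sc r \<rho> \<sigma>"
  unfolding sc_def sc0_def
proof (rule INF_greatest)
  fix T :: "nat \<Rightarrow> 'a list \<Rightarrow> real"
  assume "T \<in> {T \<in> test_seqs. ereal r \<le> liminf (\<lambda>n. rate n (SUP \<omega>\<in>iid {\<sigma>} n. test_prob n \<omega> (T n)))}"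
  then have T: "T \<in> test_seqs" and feasible: "ereal r \<le> liminf (\<lambda>n. rate n (test_prob n (tensor_power n \<sigma>) (T n)))"
    by (auto simp: iid_def)
  define p where "p n = test_prob n (tensor_power n \<rho>) (T n)" for n
  define q where "q n = test_prob n (tensor_power n \<sigma>) (T n)" for n
  have pq: "0 \<le> p n" "p n \<le> 1" "0 \<le> q n" for n
    unfolding p_def q_def
    by (intro test_prob_bounds tensor_power_word_density \<rho> \<sigma>, auto dest: test_seqs_bounds[OF T])+
  have "0 \<le> liminf (\<lambda>n. rate n (p n))"
    using pq by (intro Liminf_bounded always_eventually allI rate_nonneg)
  also have "\<dots> \<le> limsup (\<lambda>n. rate n (p n))" by (rule Liminf_le_Limsup) simp
  finally have nonneg: "0 \<le> limsup (\<lambda>n. rate n (p n))" .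
  have "ereal ((\<alpha> - 1) / \<alpha>) * (ereal r - renyi_div \<alpha> \<rho> \<sigma>) \<le> limsup (\<lambda>n. rate n (p n))"
    if \<alpha>: "1 < \<alpha>" for \<alpha>
  proof (cases "supp \<rho> \<subseteq> supp \<sigma>")
    case False
    \<comment> \<open>The divergence is infinite, so the left side is minus infinity.\<close>
    then show ?thesis using \<alpha> by (simp add: renyi_div_def)
  next
    case True
    define D where "D = 1 / (\<alpha> - 1) * ln (renyi_sum \<alpha> \<rho> \<sigma>)"
    have sum_eq: "renyi_sum \<alpha> \<rho> \<sigma> = exp ((\<alpha> - 1) * D)"
      using \<alpha> renyi_sum_pos[OF \<rho> \<sigma> True] by (simp add: D_def)
    \<comment> \<open>A \<open>liminf\<close> of at least \<open>r\<close> gives an eventual bound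
      only at rates \<open>r'\<close> below \<open>r\<close>; the limit
      \<open>r' \<rightarrow> r\<close> is taken afterwards.\<close>
    have bound: "ereal ((\<alpha> - 1) / \<alpha> * (r' - D)) \<le> limsup (\<lambda>n. rate n (p n))" if "r' < r" for r'
    proof -
      define g where "g = (\<alpha> - 1) / \<alpha> * (r' - D)"
      \<comment> \<open>The solution of
        \<open>k - r' = (1 - \<alpha>) * k + (\<alpha> - 1) * D\<close>; the common value is
        \<open>- g\<close>. The resulting factor 2 disappears in the limit.\<close>
      define k where "k = (r' + (\<alpha> - 1) * D) / \<alpha>"
      have k: "k - r' = - g" "(1 - \<alpha>) * k + (\<alpha> - 1) * D = - g"
        using \<alpha> by (simp_all add: k_def g_def field_simps)
      have "ereal r' < ereal r" using that by simp
      also have "\<dots> \<le> liminf (\<lambda>n. rate n (q n))" using feasible by (simp add: q_def)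
      finally have "\<forall>\<^sub>F n in sequentially. ereal r' < rate n (q n)" by (rule less_LiminfD)
      then have "\<forall>\<^sub>F n in sequentially. ereal (g - ln 2 / n) \<le> rate n (p n)"
        using eventually_gt_at_top[of 0]
      proof eventually_elim
        case (elim n)
        have "q n \<le> exp (- (n * r'))"
        proof (cases "q n = 0")
          case False
          then have "r' < 1 / n * - ln (q n)" using elim by (simp add: rate_def neg_log_def)
          then have "ln (q n) \<le> - (n * r')" using elim by (simp add: field_simps)
          then show ?thesis using False pq(3)[of n] by (metis exp_le_cancel_iff exp_ln less_eq_real_def)
        qed simp
        have "p n \<le> exp (n * k) * q n + exp (n * k) powr (1 - \<alpha>) * renyi_sum \<alpha> \<rho> \<sigma> ^ n"
          unfolding p_def q_def using \<rho> \<sigma> True \<alpha> test_seqs_bounds[OF T]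
          by (intro test_prob_converse) auto
        also have "\<dots> \<le> exp (n * k) * exp (- (n * r')) + exp (n * k) powr (1 - \<alpha>) * renyi_sum \<alpha> \<rho> \<sigma> ^ n"
          using \<open>q n \<le> exp (- (n * r'))\<close> by simp
        also have "\<dots> = exp (n * (k - r')) + exp (n * ((1 - \<alpha>) * k + (\<alpha> - 1) * D))"
          by (simp add: sum_eq powr_def algebra_simps flip: exp_add exp_of_nat_mult)
        also have "\<dots> = exp (- (n * (g - ln 2 / n)))"
        proof -
          have "- (n * (g - ln 2 / n)) = ln 2 - n * g" using elim by (simp add: right_diff_distrib)
          then show ?thesis unfolding k by (simp add: exp_diff exp_minus divide_inverse)
        qed
        finally show ?case
          using elim pq by (intro rate_ge)
      qed
      then have "liminf (\<lambda>n. ereal (g - ln 2 / n)) \<le> liminf (\<lambda>n. rate n (p n))"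
        by (rule Liminf_mono)
      moreover have "liminf (\<lambda>n. ereal (g - ln 2 / n)) = ereal g"
      proof (rule lim_imp_Liminf)
        have "(\<lambda>n. g - ln 2 / real n) \<longlonglongrightarrow> g" by real_asymp
        then show "(\<lambda>n. ereal (g - ln 2 / real n)) \<longlonglongrightarrow> ereal g" by simp
      qed simp
      moreover have "liminf (\<lambda>n. rate n (p n)) \<le> limsup (\<lambda>n. rate n (p n))"
        by (rule Liminf_le_Limsup) simp
      ultimately show ?thesis unfolding g_def by order
    qed
    have "ereal ((\<alpha> - 1) / \<alpha> * (r - D)) \<le> limsup (\<lambda>n. rate n (p n))"
    proof (rule ereal_le_epsilon2)
      fix e :: real assume e: "0 < e"
      have "(\<alpha> - 1) / \<alpha> * (r - D) \<le> (\<alpha> - 1) / \<alpha> * (r - e - D) + e"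
        using \<alpha> e by (simp add: field_simps)
      then have "ereal ((\<alpha> - 1) / \<alpha> * (r - D)) \<le> ereal ((\<alpha> - 1) / \<alpha> * (r - e - D)) + ereal e"
        by simp
      also have "\<dots> \<le> limsup (\<lambda>n. rate n (p n)) + ereal e"
        using bound[of "r - e"] e by (intro add_right_mono) simp
      finally show "ereal ((\<alpha> - 1) / \<alpha> * (r - D)) \<le> limsup (\<lambda>n. rate n (p n)) + ereal e" .
    qed
    then show ?thesis by (simp add: renyi_div_eq[OF True] D_def)
  qed
  then show "hoeffding_anti r \<rho> \<sigma> \<le> success_exponent {\<rho>} T"
    using nonneg by (auto simp: hoeffding_anti_def success_exponent_def p_def intro!: SUP_least)
qed

text \<open>A single test sequence, averaging the products of countably many dense e-variables, is
  feasible against the adversary and asymptotically optimal for every \<open>\<rho>\<close> at once.\<close>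

lemma universal_test:
  fixes C :: "(real ^ 'a::finite) set"
  assumes C: "convex C" "compact C" "C \<subseteq> densities" "C \<noteq> {}"
  obtains T where "T \<in> test_seqs"
    and "ereal r \<le> liminf (\<lambda>n. rate n (SUP \<omega>\<in>adversarial C n. test_prob n \<omega> (T n)))"
    and "\<And>\<rho>. \<rho> \<in> densities \<Longrightarrow>
      limsup (\<lambda>n. rate n (test_prob n (tensor_power n \<rho>) (T n))) \<le> hoeffding_anti_set r {\<rho>} C"
proof -
  obtain E where E: "countable E" "E \<subseteq> e_variables C" "e_variables C \<subseteq> closure E"
    using separable by blast
  have "E \<noteq> {}" using E const_1_e_variable[OF C(3)] by auto
  \<comment> \<open>An enumeration of \<open>E\<close>, with repetitions if \<open>E\<close> is
    finite.\<close>
  define e where "e = from_nat_into E"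
  have e: "e j \<in> e_variables C" for j
    using E from_nat_into[OF \<open>E \<noteq> {}\<close>] by (auto simp: e_def)
  then have e_pos: "0 < e j $ x" for j x by (simp add: e_variables_def)
  \<comment> \<open>An average of \<open>n + 1\<close> e-variable products scaled by
    \<open>exp (- (n r))\<close>, truncated to be a test. Each \<open>e j\<close> takes part from
    length \<open>j\<close> on.\<close>
  define T where "T n xs = min 1 (exp (- (n * r)) / (n + 1) * (\<Sum>j\<le>n. \<Prod>k<n. e j $ (xs ! k)))"
    for n :: nat and xs :: "'a list"
  have prod_nonneg': "0 \<le> (\<Prod>k<n. e j $ (xs ! k))" for j n and xs :: "'a list"
    using e_pos by (intro prod_nonneg) (simp add: less_imp_le)
  show thesis
  proof (rule that)
    show T: "T \<in> test_seqs"
      by (auto simp: test_seqs_def T_def intro!: divide_nonneg_nonneg mult_nonneg_nonneg sum_nonneg prod_nonneg')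
    show "ereal r \<le> liminf (\<lambda>n. rate n (SUP \<omega>\<in>adversarial C n. test_prob n \<omega> (T n)))"
    proof (rule Liminf_bounded)
      show "\<forall>\<^sub>F n in sequentially. ereal r \<le> rate n (SUP \<omega>\<in>adversarial C n. test_prob n \<omega> (T n))"
        using eventually_gt_at_top[of 0]
      proof eventually_elim
        case (elim n)
        have ne: "adversarial C n \<noteq> {}"
          using arb_varying_subset_adversarial[OF C(3) elim] arb_varying_nonempty[OF C(4)] by blast
        have "test_prob n \<omega> (T n) \<le> exp (- (n * r))" if \<omega>: "\<omega> \<in> adversarial C n" for \<omega>
        proof -
          have "0 \<le> \<omega> xs" for xs using \<omega> by (auto simp: adversarial_def word_densities_def)
          then have "test_prob n \<omega> (T n)
              \<le> (\<Sum>xs\<in>words n. \<omega> xs * (exp (- (n * r)) / (n + 1) * (\<Sum>j\<le>n. \<Prod>k<n. e j $ (xs ! k))))"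
            unfolding test_prob_def by (intro sum_mono mult_left_mono) (auto simp: T_def)
          also have "\<dots> = exp (- (n * r)) / (n + 1) * (\<Sum>xs\<in>words n. \<Sum>j\<le>n. \<omega> xs * (\<Prod>k<n. e j $ (xs ! k)))"
            by (simp add: sum_distrib_left mult_ac)
          also have "\<dots> = exp (- (n * r)) / (n + 1) * (\<Sum>j\<le>n. \<Sum>xs\<in>words n. \<omega> xs * (\<Prod>k<n. e j $ (xs ! k)))"
            by (subst sum.swap) simp
          also have "\<dots> \<le> exp (- (n * r)) / (n + 1) * (\<Sum>j\<le>n. 1)"
            by (intro mult_left_mono sum_mono adversarial_prod_le_1[OF \<omega> e]) auto
          also have "\<dots> = exp (- (n * r))" by simp
          finally show ?thesis .
        qed
        then have "(SUP \<omega>\<in>adversarial C n. test_prob n \<omega> (T n)) \<le> exp (- (n * r))"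
          by (rule cSUP_least[OF ne])
        moreover have "0 \<le> (SUP \<omega>\<in>adversarial C n. test_prob n \<omega> (T n))"
          by (rule SUP_test_prob_nonneg[OF T _ ne]) (auto simp: adversarial_def)
        ultimately show ?case using elim by (intro rate_ge)
      qed
    qed
    fix \<rho> :: "real ^ 'a" assume \<rho>: "\<rho> \<in> densities"
    show "limsup (\<lambda>n. rate n (test_prob n (tensor_power n \<rho>) (T n))) \<le> hoeffding_anti_set r {\<rho>} C"
    proof (rule dense_ge)
      fix z assume "hoeffding_anti_set r {\<rho>} C < z"
      then obtain v where v: "hoeffding_anti_set r {\<rho>} C < ereal v" "ereal v < z"
        using ereal_dense2 by blast
      \<comment> \<open>The gap between \<open>v0\<close> and \<open>v\<close> pays for replacing
        the ideal e-variable \<open>f\<close> by a member of the dense family.\<close>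
      obtain v0 where v0: "hoeffding_anti_set r {\<rho>} C < ereal v0" "v0 < v"
        using ereal_dense2[OF v(1)] by auto
      define \<epsilon> where "\<epsilon> = v - v0"
      have "0 < \<epsilon>" using v0 by (simp add: \<epsilon>_def)
      obtain f where f: "f \<in> e_variables C"
        "\<And>t. 0 \<le> t \<Longrightarrow> t \<le> 1 \<Longrightarrow> t * r - ln (moment \<rho> f t) < v0"
        using uniform_e_variable[OF \<rho> pointwise_e_variable[OF C \<rho> v0(1)]] by blast
      have f_pos: "0 < f $ x" for x using f by (simp add: e_variables_def)
      \<comment> \<open>At this distance every coordinate keeps at least the fraction
        \<open>exp (- \<epsilon>)\<close> of \<open>f\<close>, so the log moment at \<open>t\<close>
        drops by at most \<open>\<epsilon> * t\<close>, hence by at most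
        \<open>\<epsilon>\<close>.\<close>
      define \<delta> where "\<delta> = Min (range (\<lambda>x. (1 - exp (- \<epsilon>)) * f $ x))"
      have "0 < \<delta>" using \<open>0 < \<epsilon>\<close> f_pos by (simp add: \<delta>_def)
      then obtain y where y: "y \<in> E" "dist y f < \<delta>"
        using E f closure_approachable[of f E] by blast
      then obtain j where j: "y = e j"
        using from_nat_into_surj[OF E(1)] by (metis e_def)
      have approx: "exp (- \<epsilon>) * f $ x \<le> e j $ x" for x
      proof -
        have "f $ x - y $ x \<le> dist y f"
          using component_le_norm_cart[of "y - f" x] by (simp add: dist_norm)
        also have "\<dots> \<le> (1 - exp (- \<epsilon>)) * f $ x"
          using y(2) by (auto simp: \<delta>_def intro: less_imp_le)
        finally show ?thesis by (simp add: j algebra_simps)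
      qed
      have "t * r - ln (moment \<rho> (e j) t) \<le> v" if t: "0 \<le> t" "t \<le> 1" for t
      proof -
        have "exp (- (\<epsilon> * t)) * moment \<rho> f t = (\<Sum>x\<in>UNIV. \<rho> $ x * (exp (- \<epsilon>) * f $ x) powr t)"
          using f_pos by (simp add: moment_def sum_distrib_left powr_mult exp_powr_real mult_ac)
        also have "\<dots> \<le> moment \<rho> (e j) t"
          unfolding moment_def using t f_pos
          by (intro sum_mono mult_left_mono powr_mono2 approx) (auto simp: densities_nonneg \<rho> less_imp_le)
        finally have "ln (exp (- (\<epsilon> * t)) * moment \<rho> f t) \<le> ln (moment \<rho> (e j) t)"
          using moment_pos[OF \<rho> f_pos] by (intro ln_mono) auto
        then have "ln (moment \<rho> f t) - \<epsilon> * t \<le> ln (moment \<rho> (e j) t)"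
          using moment_pos[OF \<rho> f_pos, of t] by (simp add: ln_mult)
        moreover have "\<epsilon> * t \<le> \<epsilon>" using t \<open>0 < \<epsilon>\<close> by simp
        ultimately show ?thesis using f(2)[OF t] by (simp add: \<epsilon>_def)
      qed
      moreover have "\<forall>\<^sub>F n in sequentially. \<forall>xs\<in>words n.
          min 1 (exp (- (n * r)) / (n + 1) * (\<Prod>k<n. e j $ (xs ! k))) \<le> T n xs"
        using eventually_ge_at_top[of j]
      proof eventually_elim
        case (elim n)
        have "(\<Prod>k<n. e j $ (xs ! k)) \<le> (\<Sum>j\<le>n. \<Prod>k<n. e j $ (xs ! k))" for xs :: "'a list"
          using elim by (intro member_le_sum prod_nonneg') auto
        then show ?case
          unfolding T_def by (intro ballI min.mono mult_left_mono) auto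
      qed
      ultimately have "limsup (\<lambda>n. rate n (test_prob n (tensor_power n \<rho>) (T n))) \<le> ereal v"
        by (intro limsup_rate_le[OF \<rho> e_pos])
      then show "limsup (\<lambda>n. rate n (test_prob n (tensor_power n \<rho>) (T n))) \<le> z"
        using v(2) by order
    qed
  qed
qed

section \<open>Closing the chain of exponents\<close>

text \<open>The test sequence is chosen before the supremum over \<open>R\<close> is taken; as the
  universal test does not depend on \<open>\<rho>\<close>, the pointwise bounds pass to the
  supremum.\<close>

lemma sc0_adversarial_le:
  assumes C: "convex C" "compact C" "C \<subseteq> densities" "C \<noteq> {}" and R: "R \<subseteq> densities"
  shows "sc0 r R (adversarial C) \<le> hoeffding_anti_set r R C"
proof -
  obtain T where T: "T \<in> test_seqs"
    "ereal r \<le> liminf (\<lambda>n. rate n (SUP \<omega>\<in>adversarial C n. test_prob n \<omega> (T n)))"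
    "\<And>\<rho>. \<rho> \<in> densities \<Longrightarrow>
      limsup (\<lambda>n. rate n (test_prob n (tensor_power n \<rho>) (T n))) \<le> hoeffding_anti_set r {\<rho>} C"
    using universal_test[OF C] by blast
  have "sc0 r R (adversarial C) \<le> success_exponent R T"
    unfolding sc0_def using T(1,2) by (intro INF_lower) simp
  also have "\<dots> \<le> hoeffding_anti_set r R C"
    unfolding success_exponent_def
  proof (rule SUP_least)
    fix \<rho> assume \<rho>: "\<rho> \<in> R"
    then have "limsup (\<lambda>n. rate n (test_prob n (tensor_power n \<rho>) (T n))) \<le> hoeffding_anti_set r {\<rho>} C"
      using R T(3) by blast
    also have "\<dots> \<le> hoeffding_anti_set r R C"
      unfolding hoeffding_anti_set_def using \<rho> by (intro SUP_subset_mono) auto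
    finally show "limsup (\<lambda>n. rate n (test_prob n (tensor_power n \<rho>) (T n))) \<le> hoeffding_anti_set r R C" .
  qed
  finally show ?thesis .
qed

lemma adversarial_word_densities: "adversarial A n \<subseteq> word_densities n"
  by (auto simp: adversarial_def)

text \<open>The classical formula for simple hypotheses. Achievability is the composite bound for
  the compact convex set \<open>{\<sigma>}\<close>, against whose adversary the i.i.d. alternative
  is a special case.\<close>

lemma sc_eq_hoeffding_anti:
  assumes \<rho>: "\<rho> \<in> densities" and \<sigma>: "\<sigma> \<in> densities"
  shows "sc r \<rho> \<sigma> = hoeffding_anti r \<rho> \<sigma>"
proof (rule antisym)
  have "sc r \<rho> \<sigma> \<le> sc0 r {\<rho>} (adversarial {\<sigma>})"
    unfolding sc_def using \<sigma>
    by (intro sc0_mono adversarial_word_densities iid_nonempty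
        order_trans[OF iid_subset_arb_varying arb_varying_subset_adversarial]) auto
  also have "\<dots> \<le> hoeffding_anti_set r {\<rho>} {\<sigma>}"
    using \<rho> \<sigma> by (intro sc0_adversarial_le) auto
  finally show "sc r \<rho> \<sigma> \<le> hoeffding_anti r \<rho> \<sigma>"
    by (simp add: hoeffding_anti_set_def)
qed (rule hoeffding_anti_le_sc[OF \<rho> \<sigma>])

lemma convex_densities: "convex (densities :: (real ^ 'a::finite) set)"
proof (rule convexI)
  fix \<rho> \<sigma> :: "real ^ 'a" and a b :: real
  assume "\<rho> \<in> densities" "\<sigma> \<in> densities" "0 \<le> a" "0 \<le> b" "a + b = 1"
  then show "a *\<^sub>R \<rho> + b *\<^sub>R \<sigma> \<in> densities"
    by (simp add: densities_def sum.distrib flip: sum_distrib_left)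
qed

lemma compact_densities: "compact (densities :: (real ^ 'a::finite) set)"
proof -
  have "norm \<rho> \<le> 1" if "\<rho> \<in> densities" for \<rho> :: "real ^ 'a"
    using norm_le_l1_cart[of \<rho>] that by (simp add: densities_def)
  then have "bounded (densities :: (real ^ 'a) set)"
    by (auto simp: bounded_iff)
  moreover have "closed (densities :: (real ^ 'a) set)"
    unfolding densities_def
    by (intro closed_Collect_conj closed_Collect_all closed_Collect_le closed_Collect_eq continuous_intros)
  ultimately show ?thesis by (simp add: compact_eq_bounded_closed)
qed

theorem corollaryV23:
  fixes R S :: "(real ^ 'a::finite) set" and r :: real
  assumes "R \<subseteq> densities" and "R \<noteq> {}"
    and "S \<subseteq> densities" and "S \<noteq> {}"
    and "\<forall>\<rho>\<in>R. rel_entropy_set \<rho> S < max_div_set \<rho> S"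
    and "r > 0"
  shows
    "hoeffding_anti_set r R (closure (convex hull S))
       = (SUP \<rho>\<in>R. SUP \<sigma>\<in>closure (convex hull S). sc r \<rho> \<sigma>)
     \<and> (SUP \<rho>\<in>R. SUP \<sigma>\<in>closure (convex hull S). sc r \<rho> \<sigma>)
       \<ge> sc0 r R (adversarial (closure (convex hull S)))
     \<and> sc0 r R (adversarial (closure (convex hull S))) \<ge> sc0 r R (adversarial S)
     \<and> sc0 r R (adversarial S) \<ge> sc0 r R (arb_varying S)
     \<and> sc0 r R (arb_varying S) = sc0 r R (arb_varying (closure (convex hull S)))
     \<and> sc0 r R (arb_varying (closure (convex hull S))) \<ge> sc0 r R (iid (closure (convex hull S)))
     \<and> sc0 r R (iid (closure (convex hull S))) \<ge> sc01 r R (closure (convex hull S))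
     \<and> sc01 r R (closure (convex hull S))
       \<ge> (SUP \<rho>\<in>R. SUP \<sigma>\<in>closure (convex hull S). sc r \<rho> \<sigma>)
     \<and> (SUP \<rho>\<in>R. SUP \<sigma>\<in>closure (convex hull S). sc r \<rho> \<sigma>)
       = sc0 r R (adversarial (closure (convex hull S)))
     \<and> sc0 r R (adversarial (closure (convex hull S))) = sc0 r R (adversarial S)
     \<and> sc0 r R (adversarial S) = sc0 r R (arb_varying S)
     \<and> sc0 r R (arb_varying (closure (convex hull S))) = sc0 r R (iid (closure (convex hull S)))
     \<and> sc0 r R (iid (closure (convex hull S))) = sc01 r R (closure (convex hull S))
     \<and> sc01 r R (closure (convex hull S))
       = (SUP \<rho>\<in>R. SUP \<sigma>\<in>closure (convex hull S). sc r \<rho> \<sigma>)"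
proof -
  define C where "C = closure (convex hull S)"
  define M where "M = (SUP \<rho>\<in>R. SUP \<sigma>\<in>C. sc r \<rho> \<sigma>)"
  have SC: "S \<subseteq> C"
    unfolding C_def by (rule subset_trans[OF hull_subset closure_subset])
  have dens: "C \<subseteq> densities"
    unfolding C_def using assms(3) compact_densities convex_densities
    by (intro closure_minimal hull_minimal compact_imp_closed)
  have C: "convex C" "compact C" "C \<noteq> {}"
  proof -
    show "convex C" by (simp add: C_def convex_closure)
    show "compact C"
      using compact_densities dens
      by (metis C_def closed_closure compact_Int_closed inf.absorb2)
    show "C \<noteq> {}" using SC assms(4) by blast
  qed
  have "hoeffding_anti_set r R C = M"
    unfolding hoeffding_anti_set_def M_def using assms(1) dens
    by (intro SUP_cong refl) (simp add: sc_eq_hoeffding_anti subset_iff)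
  moreover have "sc0 r R (adversarial C) \<le> hoeffding_anti_set r R C"
    by (rule sc0_adversarial_le) (use C dens assms(1) in auto)
  moreover have "sc0 r R (adversarial S) \<le> sc0 r R (adversarial C)"
    using arb_varying_subset_adversarial[OF assms(3)] arb_varying_nonempty[OF assms(4)]
    by (intro sc0_mono adversarial_mono SC adversarial_word_densities) blast
  moreover have "sc0 r R (arb_varying S) \<le> sc0 r R (adversarial S)"
    using assms(3,4)
    by (intro sc0_mono arb_varying_subset_adversarial arb_varying_nonempty adversarial_word_densities)
  moreover have "sc0 r R (arb_varying S) = sc0 r R (arb_varying C)"
    unfolding C_def using assms(4) dens by (intro sc0_arb_varying_hull) (simp_all add: C_def)
  moreover have "sc0 r R (iid C) \<le> sc0 r R (arb_varying C)"
    using C dens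
    by (intro sc0_mono iid_subset_arb_varying iid_nonempty arb_varying_word_densities)
  moreover have "sc01 r R C \<le> sc0 r R (iid C)"
    by (rule sc01_le_sc0_iid[OF dens])
  moreover have "M \<le> sc01 r R C"
    unfolding M_def by (intro SUP_least sc_le_sc01)
  \<comment> \<open>The inequalities form a cycle from \<open>M\<close> back to \<open>M\<close>,
    which forces all the equalities.\<close>
  ultimately show ?thesis
    unfolding C_def[symmetric] M_def[symmetric] by (intro conjI) order+
qed

end
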